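(* There exist constants $\varepsilon_0\in(0,1)$, $N_0$ and $C>0$, which do not depend on $N$, $\varepsilon$, $A$ or $B$ (they may depend on the phase $\Psi$), such that for every $0<\varepsilon\le\varepsilon_0$ there exists an integer $q_\varepsilon\ge2$ with $q_\varepsilon\le C\log^2(1/\varepsilon)$ for which the following holds. Let $N\ge N_0$ be a power of $2$ and let $A\in T_X$ and $B\in T_P$ be boxes obeying $w(A)\,w(B)=1/N$. (1) When $w(B)\le1/\sqrt N$, the Lagrange interpolation of $e^{2\pi i N R^{AB}(x,p)}$ in $p$ on the $q_\varepsilon\times q_\varepsilon$ Chebyshev grid $\{p^B_t\}$ adapted to $B$ obeys $$\left|e^{2\pi i N R^{AB}(x,p)}-\sum_t e^{2\pi i N R^{AB}(x,p^B_t)}\,L^B_t(p)\right|\le\varepsilon\qquad\text{for all }x\in A,\ p\in B .$$ (2) When $w(A)\le1/\sqrt N$, the Lagrange interpolation of $e^{2\pi i N R^{AB}(x,p)}$ in $x$ on the $q_\varepsilon\times q_\varepsilon$ Chebyshev grid $\{x^A_t\}$ adapted to $A$ obeys $$\left|e^{2\pi i N R^{AB}(x,p)}-\sum_t L^A_t(x)\,e^{2\pi i N R^{AB}(x^A_t,p)}\right|\le\varepsilon\qquad\text{for all }x\in A,\ p\in B .$$ Both (1) and (2) provide a low-rank (separated) approximation with $r_\varepsilon=q_\varepsilon^2\le C^2\log^4(1/\varepsilon)$ terms.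
   Context: Multi-indices: for $i=(i_1,i_2)$ with integers $i_1,i_2\ge0$, $|i|=i_1+i_2$ and $i!=i_1!\,i_2!$. Phase: $\Phi(x,k)$ is a real-valued phase function, $x\in[0,1]^2$, $k\in\mathbb R^2$, smooth in $(x,k)$ for $k\ne0$ and homogeneous of degree 1 in $k$: $\Phi(x,\lambda k)=\lambda\Phi(x,k)$ for all $\lambda>0$. For $x\in[0,1]^2$ and $p=(p_1,p_2)\in[0,1]^2$ set $$\Psi(x,p)=\frac{\sqrt2}{2}\,\Phi\big(x,(\cos2\pi p_2,\sin2\pi p_2)\big)\,p_1 .$$ It is assumed that $\Psi$ is real-analytic in the joint variables $(x,p)$, in the sense that there are constants $Q,R>0$ with $$\sup_{x,p\in[0,1]^2}\left|\partial_x^i\partial_p^j\Psi(x,p)\right|\le Q\,i!\,j!\,R^{-|i|-|j|}\qquad\text{for all multi-indices } i,j .$$ The function $\Psi$ is fixed and independent of $N$. Trees: for $N$ a power of 2, $T_X$ (in the $x$ variable) and $T_P$ (in the $p$ variable) are the quadtrees obtained by uniform recursive dyadic partitioning of $[0,1]^2$ until the finest boxes have sidelength $1/N$; thus their boxes are the dyadic squares in $[0,1]^2$ of sidelength $2^{-\ell}$, $\ell=0,1,\dots,\log_2N$. For a box, $w(\cdot)$ denotes its sidelength; $x_0(A)$ is the center of $A\in T_X$ and $p_0(B)$ is the center of $B\in T_P$. Residual phase: for $x\in A$, $p\in B$, $$R^{AB}(x,p)=\Psi(x,p)-\Psi(x_0(A),p)-\Psi(x,p_0(B))+\Psi(x_0(A),p_0(B))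 .$$ Chebyshev grids and Lagrange interpolation: for an integer $q\ge2$, the Chebyshev grid of order $q$ on $[-1/2,1/2]$ is $z_i=\frac12\cos\left(\frac{i\pi}{q-1}\right)$, $0\le i\le q-1$. The $q\times q$ (tensor-product) Chebyshev grid adapted to a square box with center $c=(c_1,c_2)$ and sidelength $w$ is the set of points $c+w(z_{t_1},z_{t_2})$, indexed by $t=(t_1,t_2)$ with $0\le t_1,t_2\le q-1$. The points of this grid are denoted $p^B_t$ for a box $B\in T_P$ and $x^A_t$ for a box $A\in T_X$. The one-dimensional Lagrange polynomials of distinct nodes $\{\zeta_i\}_{0\le i\le q-1}$ are $L_i(z;\{\zeta_i\})=\prod_{0\le j\le q-1,\,j\ne i}\frac{z-\zeta_j}{\zeta_i-\zeta_j}$. For a box with center $c$ and sidelength $w$, the 2D Lagrange interpolation polynomial at index $t=(t_1,t_2)$ is $$L_t(y)=L_{t_1}\big(y_1;\{c_1+wz_i\}_i\big)\,L_{t_2}\big(y_2;\{c_2+wz_i\}_i\big),$$ and it is denoted $L^B_t$ for the box $B$ and $L^A_t$ for the box $A$. Sums over $t$ run over all $q_\varepsilon^2$ indices of the grid. *)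

theory Defs
  imports "HOL-Analysis.Analysis"
begin

type_synonym point = "real \<times> real"

definition unit_square :: "point set" where
  "unit_square = cbox (0, 0) (1, 1)"


text \<open>
  Derivatives are Frechet derivatives within the domain. They are one-sided at boundary points,
  and unique on the domains used below, which are products of the unit square with itself or with
  an open set.
\<close>

definition partial_within ::
    "'a::euclidean_space set \<Rightarrow> 'a \<Rightarrow> ('a \<Rightarrow> real) \<Rightarrow> 'a \<Rightarrow> real" where
  "partial_within S b f z = frechet_derivative f (at z within S) b"

primrec k_times_cont_diff_on ::
    "nat \<Rightarrow> ('a::euclidean_space \<Rightarrow> real) \<Rightarrow> 'a set \<Rightarrow> bool" where
  "k_times_cont_diff_on 0 f S \<longleftrightarrow> continuous_on S f"
| "k_times_cont_diff_on (Suc k) f S \<longleftrightarrow>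
     f differentiable_on S \<and> (\<forall>b\<in>Basis. k_times_cont_diff_on k (partial_within S b f) S)"

definition smooth_within :: "('a::euclidean_space \<Rightarrow> real) \<Rightarrow> 'a set \<Rightarrow> bool" where
  "smooth_within f S \<longleftrightarrow> (\<forall>k. k_times_cont_diff_on k f S)"


type_synonym multi_index = "nat \<times> nat"

definition mi_abs :: "multi_index \<Rightarrow> nat" where
  "mi_abs i = fst i + snd i"

definition mi_fact :: "multi_index \<Rightarrow> real" where
  "mi_fact i = fact (fst i) * fact (snd i)"

text \<open>\<open>mixed_partial i j F x p\<close> is $\partial_x^i \partial_p^j F(x,p)$ on the product of two
  unit squares.\<close>

definition mixed_partial ::
    "multi_index \<Rightarrow> multi_index \<Rightarrow> (point \<Rightarrow> point \<Rightarrow> real) \<Rightarrow> point \<Rightarrow> point \<Rightarrow> real" where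
  "mixed_partial i j F x p =
     (let D = partial_within (unit_square \<times> unit_square) in
       ((D ((1, 0), (0, 0)) ^^ fst i) ((D ((0, 1), (0, 0)) ^^ snd i)
         ((D ((0, 0), (1, 0)) ^^ fst j) ((D ((0, 0), (0, 1)) ^^ snd j)
           (\<lambda>(x, p). F x p))))) (x, p))"

text \<open>The bound presupposes that the derivatives exist; since \<^const>\<open>frechet_derivative\<close> is
  total, this is required explicitly.\<close>

definition jointly_real_analytic :: "(point \<Rightarrow> point \<Rightarrow> real) \<Rightarrow> bool" where
  "jointly_real_analytic F \<longleftrightarrow>
     smooth_within (\<lambda>(x, p). F x p) (unit_square \<times> unit_square) \<and>
     (\<exists>Q R. Q > 0 \<and> R > 0 \<and>
       (\<forall>i j. \<forall>x\<in>unit_square. \<forall>p\<in>unit_square.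
         \<bar>mixed_partial i j F x p\<bar>
           \<le> Q * mi_fact i * mi_fact j * (1 / R) ^ (mi_abs i + mi_abs j)))"

definition phase_function :: "(point \<Rightarrow> point \<Rightarrow> real) \<Rightarrow> bool" where
  "phase_function \<Phi> \<longleftrightarrow>
     smooth_within (\<lambda>(x, k). \<Phi> x k) (unit_square \<times> (UNIV - {(0, 0)})) \<and>
     (\<forall>x\<in>unit_square. \<forall>k. \<forall>c>0. \<Phi> x (c *\<^sub>R k) = c * \<Phi> x k)"

definition polar_phase :: "(point \<Rightarrow> point \<Rightarrow> real) \<Rightarrow> point \<Rightarrow> point \<Rightarrow> real" where
  "polar_phase \<Phi> x p =
     sqrt 2 / 2 * \<Phi> x (cos (2 * pi * snd p), sin (2 * pi * snd p)) * fst p"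


text \<open>A square box is given by its center and sidelength; \<open>region\<close> is the closed set of its
  points.\<close>

datatype square = Square (center: point) (width: real)

definition region :: "square \<Rightarrow> point set" where
  "region A = cbox (center A - (width A / 2, width A / 2)) (center A + (width A / 2, width A / 2))"

definition quadtree :: "nat \<Rightarrow> square set" where
  "quadtree N =
     {Square ((real m + 1/2) / 2 ^ l, (real n + 1/2) / 2 ^ l) (1 / 2 ^ l) | l m n :: nat.
        2 ^ l \<le> N \<and> m < 2 ^ l \<and> n < 2 ^ l}"

definition residual_phase ::
    "(point \<Rightarrow> point \<Rightarrow> real) \<Rightarrow> square \<Rightarrow> square \<Rightarrow> point \<Rightarrow> point \<Rightarrow> real" where
  "residual_phase \<Psi> A B x p =
     \<Psi> x p - \<Psi> (center A) p - \<Psi> x (center B) + \<Psi> (center A) (center B)"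

definition residual_kernel ::
    "(point \<Rightarrow> point \<Rightarrow> real) \<Rightarrow> nat \<Rightarrow> square \<Rightarrow> square \<Rightarrow> point \<Rightarrow> point \<Rightarrow> complex" where
  "residual_kernel \<Psi> N A B x p =
     exp (2 * of_real pi * \<i> * of_nat N * of_real (residual_phase \<Psi> A B x p))"


definition cheb_node :: "nat \<Rightarrow> nat \<Rightarrow> real" where
  "cheb_node q i = cos (real i * pi / (real q - 1)) / 2"

definition cheb_grid :: "nat \<Rightarrow> square \<Rightarrow> nat \<times> nat \<Rightarrow> point" where
  "cheb_grid q A t = center A + width A *\<^sub>R (cheb_node q (fst t), cheb_node q (snd t))"

definition lagrange_poly :: "nat \<Rightarrow> (nat \<Rightarrow> real) \<Rightarrow> nat \<Rightarrow> real \<Rightarrow> real" where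
  "lagrange_poly q \<zeta> i z = (\<Prod>j\<in>{..<q} - {i}. (z - \<zeta> j) / (\<zeta> i - \<zeta> j))"

definition lagrange_poly2 :: "nat \<Rightarrow> square \<Rightarrow> nat \<times> nat \<Rightarrow> point \<Rightarrow> real" where
  "lagrange_poly2 q A t y =
     lagrange_poly q (\<lambda>i. fst (center A) + width A * cheb_node q i) (fst t) (fst y) *
     lagrange_poly q (\<lambda>i. snd (center A) + width A * cheb_node q i) (snd t) (snd y)"

definition separated_approx ::
    "nat \<Rightarrow> real \<Rightarrow> point set \<Rightarrow> point set \<Rightarrow> (point \<Rightarrow> point \<Rightarrow> complex) \<Rightarrow> bool" where
  "separated_approx r \<epsilon> S T f \<longleftrightarrow>
     (\<exists>\<alpha> \<beta> :: nat \<Rightarrow> point \<Rightarrow> complex. \<forall>x\<in>S. \<forall>p\<in>T.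
        norm (f x p - (\<Sum>t<r. \<alpha> t x * \<beta> t p)) \<le> \<epsilon>)"

end

theory Submission
  imports Defs "HOL-Computational_Algebra.Polynomial"
begin

text \<open>
  Fix \<open>x \<in> A\<close> and restrict $2\pi N R^{AB}(x,p)$ to a line in $B$ parallel to an axis. By the mean
  value theorem in \<open>x\<close>, its Taylor coefficients of order $k \ge 1$ are bounded by
  $2\pi N\, w(A)\, Q s^k = (2\pi Q / w(B))\, s^k$. The coefficients of the exponential obey a
  recursion which turns this into the bound $M / (144\, w(B))^n$ for order \<open>n\<close>, where \<open>M\<close> depends
  only on the constants \<open>Q\<close> and \<open>s\<close> of the phase; here $w(B) \le 1/\sqrt{N_0}$ makes room for the large radius $144\, w(B)$.
  Hence the one-dimensional Lagrange remainder is at most $2M \cdot 144^{-q}$. The tensor product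
  error costs another factor $1 + q\, 36^q$, from a crude bound on the Lagrange polynomials of the
  Chebyshev grid. So $q$ proportional to $\log(1/\varepsilon)$ already suffices.
\<close>

subsection \<open>Remainder of Lagrange interpolation\<close>

text \<open>The obstacle is the size of the phase: along a line in \<open>B\<close> its slope is
  only bounded by a multiple of 1 / w(B), which grows with N. The way out is a cancellation. With a
  radius r proportional to w(B), every rescaled phase coefficient of order k \<ge> 1 contains at
  least one factor w(B), and this factor pays for 1 / w(B). The quantity K = 4 * (2 pi Q / w(B)) *
  (144 w(B) s) = 1152 pi Q s that controls the exponential is therefore free of N and of the boxes.
  The coefficient of order 0 may have any size, because a unimodular factor does not affect the
  norm.

  The number 144 is 36 * 2 * 2: base 36 bounds the Lagrange polynomials, one factor 2 per degree
  absorbs the number q of nodes, and the last one is left over as the decay 2^-q.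

  Analyticity is given as bounds on real derivatives over closed squares, one-sided at the edges.
  The remainder is therefore estimated by Rolle's theorem on a closed interval and not by a contour
  integral. Interpolation in \<open>x\<close> follows from interpolation in \<open>p\<close> by
  exchanging the two variables and the two boxes.\<close>

lemma iterated_Rolle:
  fixes h :: "nat \<Rightarrow> real \<Rightarrow> real"
  assumes "\<And>k t. k < n \<Longrightarrow> t \<in> {a..b} \<Longrightarrow> (h k has_real_derivative h (Suc k) t) (at t within {a..b})"
    and "\<And>i. i < n \<Longrightarrow> z i < z (Suc i)"
    and "\<And>i. i \<le> n \<Longrightarrow> z i \<in> {a..b}"
    and "\<And>i. i \<le> n \<Longrightarrow> h 0 (z i) = 0"
  shows "\<exists>\<xi>\<in>{a..b}. h n \<xi> = 0"
  using assms
proof (induction n arbitrary: h z)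
  case 0
  then show ?case by auto
next
  case (Suc n)
  have "\<exists>y>z i. y < z (Suc i) \<and> h 1 y = 0" if i: "i \<le> n" for i
  proof -
    have lt: "z i < z (Suc i)" and za: "a \<le> z i" and zb: "z (Suc i) \<le> b"
      using Suc.prems(2,3)[of i] Suc.prems(3)[of "Suc i"] i by auto
    have cont: "continuous_on {z i..z (Suc i)} (h 0)"
    proof (rule continuous_on_subset)
      show "continuous_on {a..b} (h 0)"
        using Suc.prems(1)[of 0] by (intro DERIV_continuous_on) auto
    qed (use za zb in auto)
    have der: "(h 0 has_derivative (*) (h 1 t)) (at t)" if "z i < t" "t < z (Suc i)" for t
      using Suc.prems(1)[of 0 t] that za zb
      by (simp add: at_within_Icc_at has_field_derivative_def)
    obtain y where y: "z i < y" "y < z (Suc i)" "(*) (h 1 y) = (\<lambda>v. 0)"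
      using Rolle_deriv[OF lt _ cont der] Suc.prems(4)[of i] Suc.prems(4)[of "Suc i"] i by auto
    have "h 1 y = 0" using fun_cong[OF y(3), of 1] by simp
    with y show ?thesis by blast
  qed
  then obtain y where y: "\<And>i. i \<le> n \<Longrightarrow> z i < y i \<and> y i < z (Suc i) \<and> h 1 (y i) = 0"
    by metis
  have "\<exists>\<xi>\<in>{a..b}. h (Suc n) \<xi> = 0"
  proof (rule Suc.IH[of "\<lambda>k. h (Suc k)" y])
    show "y i < y (Suc i)" if "i < n" for i
      using y[of i] y[of "Suc i"] that by auto
    show "y i \<in> {a..b}" if "i \<le> n" for i
      using y[of i] Suc.prems(3)[of i] Suc.prems(3)[of "Suc i"] that by auto
  qed (use Suc.prems(1) y in auto)
  then show ?case .
qed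

text \<open>The zeros met later, the nodes together with the evaluation point, come in no increasing
  order. Sorting them supplies the sequence that the iteration of Rolle's theorem runs on.\<close>

lemma iterated_Rolle_card:
  fixes h :: "nat \<Rightarrow> real \<Rightarrow> real"
  assumes h: "\<And>k t. k < n \<Longrightarrow> t \<in> {a..b} \<Longrightarrow> (h k has_real_derivative h (Suc k) t) (at t within {a..b})"
    and Z: "finite Z" "card Z = Suc n" "Z \<subseteq> {a..b}" "\<And>z. z \<in> Z \<Longrightarrow> h 0 z = 0"
  shows "\<exists>\<xi>\<in>{a..b}. h n \<xi> = 0"
proof -
  define zs where "zs = sorted_list_of_set Z"
  have len: "length zs = Suc n" and set: "set zs = Z" and srt: "sorted_wrt (<) zs"
    using Z by (auto simp: zs_def strict_sorted_list_of_set)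
  have mem: "zs ! i \<in> Z" if "i \<le> n" for i
    using nth_mem[of i zs] that len set by auto
  show ?thesis
    by (rule iterated_Rolle[of n a b h "(!) zs"])
      (use h mem Z srt len in \<open>auto simp: sorted_wrt_nth_less subset_iff\<close>)
qed

lemma lagrange_poly_node:
  assumes "inj_on \<zeta> {..<q}" "i < q" "j < q"
  shows "lagrange_poly q \<zeta> i (\<zeta> j) = (if i = j then 1 else 0)"
proof (cases "i = j")
  case True
  then show ?thesis
    using assms unfolding lagrange_poly_def inj_on_def by (auto intro!: prod.neutral split: if_splits)
next
  case False
  then show ?thesis using assms unfolding lagrange_poly_def
    by (auto intro!: prod_zero bexI[of _ j])
qed

lemma lagrange_poly_as_poly:
  assumes "i < q"
  obtains p where "degree p < q" "\<And>z. poly p z = lagrange_poly q \<zeta> i z"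
proof
  let ?f = "\<lambda>j. smult (inverse (\<zeta> i - \<zeta> j)) [:- \<zeta> j, 1:]"
  let ?p = "\<Prod>j\<in>{..<q} - {i}. ?f j"
  have "degree ?p \<le> sum (degree \<circ> ?f) ({..<q} - {i})"
    by (rule degree_prod_sum_le) simp
  also have "\<dots> \<le> (\<Sum>j\<in>{..<q} - {i}. 1)"
    by (rule sum_mono) (auto)
  also have "\<dots> < q" using assms by simp
  finally show "degree ?p < q" .
  show "poly ?p z = lagrange_poly q \<zeta> i z" for z
    by (simp add: lagrange_poly_def poly_prod divide_inverse mult.commute algebra_simps)
qed

text \<open>Cauchy's argument: away from the nodes, subtract from \<open>h 0\<close> its interpolant
  plus a multiple of the node polynomial that creates one more zero at \<open>t\<close>. The
  difference has q + 1 zeros, so its derivative of order q vanishes somewhere. At a node both sides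
  are zero and any point of the interval serves.\<close>

lemma lagrange_interpolation_remainder:
  fixes h :: "nat \<Rightarrow> real \<Rightarrow> real"
  assumes h: "\<And>k t. k < q \<Longrightarrow> t \<in> {a..b} \<Longrightarrow> (h k has_real_derivative h (Suc k) t) (at t within {a..b})"
    and inj: "inj_on \<zeta> {..<q}" and \<zeta>: "\<And>i. i < q \<Longrightarrow> \<zeta> i \<in> {a..b}" and t: "t \<in> {a..b}"
  shows "\<exists>\<xi>\<in>{a..b}. h 0 t - (\<Sum>i<q. h 0 (\<zeta> i) * lagrange_poly q \<zeta> i t)
           = h q \<xi> / fact q * (\<Prod>i<q. t - \<zeta> i)"
proof (cases "t \<in> \<zeta> ` {..<q}")
  case True
  then obtain j where j: "j < q" "t = \<zeta> j" by auto
  have "(\<Sum>i<q. h 0 (\<zeta> i) * lagrange_poly q \<zeta> i t) = (\<Sum>i<q. if i = j then h 0 (\<zeta> i) else 0)"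
    using j lagrange_poly_node[OF inj] by (intro sum.cong) auto
  moreover have "(\<Prod>i<q. t - \<zeta> i) = 0" using j by (auto intro!: prod_zero)
  ultimately show ?thesis using j t by auto
next
  case False
  let ?w = "\<Prod>i<q. t - \<zeta> i"
  have w0: "?w \<noteq> 0" using False by auto
  have "\<forall>i. \<exists>p. i < q \<longrightarrow> degree p < q \<and> (\<forall>z. poly p z = lagrange_poly q \<zeta> i z)"
    by (meson lagrange_poly_as_poly)
  from choice[OF this] obtain L where L: "\<And>i. i < q \<Longrightarrow> degree (L i) < q"
      "\<And>i z. i < q \<Longrightarrow> poly (L i) z = lagrange_poly q \<zeta> i z"
    by auto
  define p where "p = (\<Sum>i<q. smult (h 0 (\<zeta> i)) (L i))"
  define \<omega> where "\<omega> = (\<Prod>i<q. [:- \<zeta> i, 1:])"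
  have poly_p: "poly p z = (\<Sum>i<q. h 0 (\<zeta> i) * lagrange_poly q \<zeta> i z)" for z
    by (simp add: p_def poly_sum L)
  have poly_\<omega>: "poly \<omega> z = (\<Prod>i<q. z - \<zeta> i)" for z
    by (simp add: \<omega>_def poly_prod)
  \<comment> \<open>This is the unique multiple of \<open>\<omega>\<close> for which
    \<open>h 0 - r\<close> also vanishes at \<open>t\<close>.\<close>
  define \<kappa> where "\<kappa> = (h 0 t - poly p t) / ?w"
  define r where "r = p + smult \<kappa> \<omega>"
  have deg\<omega>: "degree \<omega> = q"
    unfolding \<omega>_def by (subst degree_prod_eq_sum_degree) auto
  have lead: "coeff \<omega> q = 1"
    using lead_coeff_prod[of "\<lambda>i. [:- \<zeta> i, 1:]" "{..<q}"] deg\<omega> by (simp add: \<omega>_def)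
  have degp: "coeff p n = 0" if "n \<ge> q" for n
    using less_le_trans[OF L(1) that] by (auto simp: p_def coeff_sum intro!: sum.neutral coeff_eq_0)
  \<comment> \<open>The interpolant has degree below q and drops out, while \<open>\<omega>\<close>
    is monic of degree q and contributes q!.\<close>
  have "(pderiv ^^ q) r = [:fact q * \<kappa>:]"
  proof (rule poly_eqI)
    fix n
    show "coeff ((pderiv ^^ q) r) n = coeff [:fact q * \<kappa>:] n"
      using degp[of "n + q"] lead deg\<omega> pochhammer_fact[of q, where 'a = real]
      by (cases n) (auto simp: coeff_higher_pderiv r_def coeff_eq_0 add.commute)
  qed
  moreover have "\<exists>\<xi>\<in>{a..b}. h q \<xi> - poly ((pderiv ^^ q) r) \<xi> = 0"
  proof (rule iterated_Rolle_card[where Z = "insert t (\<zeta> ` {..<q})"])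
    show "((\<lambda>z. h k z - poly ((pderiv ^^ k) r) z) has_real_derivative
        h (Suc k) s - poly ((pderiv ^^ Suc k) r) s) (at s within {a..b})"
      if "k < q" "s \<in> {a..b}" for k s
      using h[OF that] by (auto intro!: derivative_eq_intros poly_DERIV[THEN DERIV_subset])
    show "card (insert t (\<zeta> ` {..<q})) = Suc q"
      using False inj by (simp add: card_image)
    fix z assume z: "z \<in> insert t (\<zeta> ` {..<q})"
    show "h 0 z - poly ((pderiv ^^ 0) r) z = 0"
    proof (cases "z = t")
      case True
      then show ?thesis using w0 by (simp add: r_def \<kappa>_def poly_\<omega>)
    next
      case False
      then obtain j where j: "j < q" "z = \<zeta> j" using z by auto
      have "poly p z = (\<Sum>i<q. if i = j then h 0 (\<zeta> i) else 0)"
        unfolding poly_p using j lagrange_poly_node[OF inj] by (intro sum.cong) auto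
      moreover have "poly \<omega> z = 0" unfolding poly_\<omega> using j by (auto intro!: prod_zero)
      ultimately show ?thesis using j by (simp add: r_def)
    qed
  qed (use \<zeta> t in auto)
  ultimately obtain \<xi> where \<xi>: "\<xi> \<in> {a..b}" "h q \<xi> = fact q * \<kappa>" by auto
  then have "h 0 t - poly p t = h q \<xi> / fact q * ?w" using w0 by (simp add: \<kappa>_def)
  then show ?thesis using \<xi>(1) unfolding poly_p by blast
qed

lemma lagrange_interpolation_error:
  fixes f :: "nat \<Rightarrow> real \<Rightarrow> complex"
  assumes f: "\<And>k t. k < q \<Longrightarrow> t \<in> {a..b} \<Longrightarrow> (f k has_vector_derivative f (Suc k) t) (at t within {a..b})"
    and bound: "\<And>t. t \<in> {a..b} \<Longrightarrow> norm (f q t) \<le> fact q * M"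
    and inj: "inj_on \<zeta> {..<q}" and \<zeta>: "\<And>i. i < q \<Longrightarrow> \<zeta> i \<in> {a..b}" and t: "t \<in> {a..b}"
  shows "norm (f 0 t - (\<Sum>i<q. f 0 (\<zeta> i) * of_real (lagrange_poly q \<zeta> i t))) \<le> 2 * M * (b - a) ^ q"
proof -
  let ?e = "f 0 t - (\<Sum>i<q. f 0 (\<zeta> i) * of_real (lagrange_poly q \<zeta> i t))"
  have part: "\<bar>T ?e\<bar> \<le> M * (b - a) ^ q"
    if T: "bounded_linear T" and TB: "\<And>z. \<bar>T z\<bar> \<le> norm z" for T :: "complex \<Rightarrow> real"
  proof -
    have "\<exists>\<xi>\<in>{a..b}. T (f 0 t) - (\<Sum>i<q. T (f 0 (\<zeta> i)) * lagrange_poly q \<zeta> i t)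
           = T (f q \<xi>) / fact q * (\<Prod>i<q. t - \<zeta> i)"
      by (rule lagrange_interpolation_remainder[OF _ inj \<zeta> t])
        (use bounded_linear.has_vector_derivative[OF T f] in
          \<open>auto simp: has_real_derivative_iff_has_vector_derivative\<close>)
    then obtain \<xi> where \<xi>: "\<xi> \<in> {a..b}"
      "T (f 0 t) - (\<Sum>i<q. T (f 0 (\<zeta> i)) * lagrange_poly q \<zeta> i t)
           = T (f q \<xi>) / fact q * (\<Prod>i<q. t - \<zeta> i)" by blast
    interpret T: bounded_linear T by (rule T)
    have "T ?e = T (f 0 t) - (\<Sum>i<q. T (f 0 (\<zeta> i)) * lagrange_poly q \<zeta> i t)"
      by (simp add: T.diff T.sum mult.commute[of _ "of_real _"] T.scaleR
          flip: scaleR_conv_of_real)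
        (simp add: mult.commute)
    also have "\<bar>\<dots>\<bar> = \<bar>T (f q \<xi>) / fact q\<bar> * (\<Prod>i<q. \<bar>t - \<zeta> i\<bar>)"
      unfolding \<xi>(2) by (simp add: abs_mult abs_prod)
    also have "\<dots> \<le> M * (\<Prod>i<q. b - a)"
    proof (rule mult_mono)
      show *: "\<bar>T (f q \<xi>) / fact q\<bar> \<le> M"
        using order_trans[OF TB bound[OF \<xi>(1)]] by (simp add: field_simps abs_div)
      show "(\<Prod>i<q. \<bar>t - \<zeta> i\<bar>) \<le> (\<Prod>i<q. b - a)"
        using \<zeta> t by (intro prod_mono) (force simp: abs_if)
      show "0 \<le> M" using * by linarith
    qed (auto intro: prod_nonneg)
    finally show ?thesis by simp
  qed
  have "norm ?e \<le> \<bar>Re ?e\<bar> + \<bar>Im ?e\<bar>" by (rule cmod_le)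
  also have "\<dots> \<le> M * (b - a) ^ q + M * (b - a) ^ q"
    by (intro add_mono part bounded_linear_Re bounded_linear_Im abs_Re_le_cmod abs_Im_le_cmod)
  finally show ?thesis by simp
qed

subsection \<open>Taylor coefficients of an oscillatory exponential\<close>

text \<open>If \<open>g k\<close> is the Taylor coefficient of order k of a function G, these are
  the Taylor coefficients of E = exp(iG). The recursion compares coefficients in E' = i G' E, and so
  replaces the combinatorial formula for derivatives of a composition.\<close>

fun exp_jet :: "(nat \<Rightarrow> real \<Rightarrow> real) \<Rightarrow> nat \<Rightarrow> real \<Rightarrow> complex" where
  "exp_jet g 0 t = cis (g 0 t)"
| "exp_jet g (Suc n) t =
     (\<Sum>k\<le>n. \<i> * of_real (real (Suc k) * g (Suc k) t) * exp_jet g (n - k) t) / of_nat (Suc n)"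

lemma exp_jet_derivative:
  assumes g: "\<And>k. (g k has_real_derivative real (Suc k) * g (Suc k) t) (at t within S)"
  shows "(exp_jet g n has_vector_derivative of_nat (Suc n) * exp_jet g (Suc n) t) (at t within S)"
proof (induction n rule: less_induct)
  case (less n)
  show ?case
  proof (cases n)
    case 0
    have "((\<lambda>t. cis (g 0 t)) has_vector_derivative (g 1 t) *\<^sub>R (\<i> * cis (g 0 t))) (at t within S)"
      using g[of 0] by (auto intro!: derivative_eq_intros simp: has_real_derivative_iff_has_vector_derivative
          has_vector_derivative_def scaleR_conv_of_real)
    then show ?thesis using 0 by (simp add: scaleR_conv_of_real mult_ac)
  next
    case (Suc m)
    define u where "u k = \<i> * of_real (real (Suc k) * g (Suc k) t)" for k
    define a where "a k = exp_jet g k t" for k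
    have du: "((\<lambda>s. \<i> * of_real (real (Suc k) * g (Suc k) s)) has_vector_derivative
        of_nat (Suc k) * u (Suc k)) (at t within S)" for k
    proof -
      have "((\<lambda>s. real (Suc k) * g (Suc k) s) has_real_derivative
          real (Suc k) * (real (Suc (Suc k)) * g (Suc (Suc k)) t)) (at t within S)"
        by (rule DERIV_cmult[OF g])
      from has_vector_derivative_mult_right[OF has_vector_derivative_of_real[OF this], of \<i>]
      show ?thesis by (simp add: u_def mult_ac)
    qed
    have da: "(exp_jet g (m - k) has_vector_derivative of_nat (Suc (m - k)) * a (Suc m - k))
        (at t within S)" if "k \<le> m" for k
      using less.IH[of "m - k"] Suc that by (simp add: a_def Suc_diff_le del: exp_jet.simps)
    have "((\<lambda>s. \<Sum>k\<le>m. \<i> * of_real (real (Suc k) * g (Suc k) s) * exp_jet g (m - k) s)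
        has_vector_derivative
        (\<Sum>k\<le>m. u k * (of_nat (Suc (m - k)) * a (Suc m - k)) + of_nat (Suc k) * u (Suc k) * a (m - k)))
        (at t within S)"
      unfolding u_def a_def
      by (intro has_vector_derivative_sum has_vector_derivative_mult)
        (use du da in \<open>auto simp: u_def a_def simp del: exp_jet.simps\<close>)
    \<comment> \<open>Shifting the index in the terms where \<open>u\<close> was differentiated
      gives them weight k, and the others have weight m + 1 - k. These weights add up to m + 1. Both
      sums may be extended to the range up to \<open>Suc m\<close>, since the terms added have
      weight 0.\<close>
    also have "(\<Sum>k\<le>m. u k * (of_nat (Suc (m - k)) * a (Suc m - k)) + of_nat (Suc k) * u (Suc k) * a (m - k))
      = of_nat (Suc m) * (\<Sum>k\<le>Suc m. u k * a (Suc m - k))"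
    proof -
      have "(\<Sum>k\<le>m. of_nat (Suc k) * u (Suc k) * a (m - k))
          = (\<Sum>k\<le>Suc m. of_nat k * u k * a (Suc m - k))"
        by (subst sum.atMost_Suc_shift) simp
      moreover have "(\<Sum>k\<le>m. u k * (of_nat (Suc (m - k)) * a (Suc m - k)))
          = (\<Sum>k\<le>Suc m. of_nat (Suc m - k) * u k * a (Suc m - k))"
        by (auto simp: Suc_diff_le mult_ac intro!: sum.cong)
      moreover have "(\<Sum>k\<le>Suc m. of_nat (Suc m - k) * u k * a (Suc m - k))
           + (\<Sum>k\<le>Suc m. of_nat k * u k * a (Suc m - k))
           = (\<Sum>k\<le>Suc m. of_nat (Suc m) * (u k * a (Suc m - k)))"
        unfolding sum.distrib[symmetric]
        by (intro sum.cong) (auto simp: of_nat_diff algebra_simps)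
      ultimately show ?thesis unfolding sum.distrib by (simp only: sum_distrib_left)
    qed
    also have "(\<Sum>k\<le>Suc m. u k * a (Suc m - k)) = of_nat (Suc (Suc m)) * a (Suc (Suc m))"
      by (simp add: u_def a_def del: of_nat_Suc)
    finally have "((\<lambda>s. of_nat (Suc m) * exp_jet g (Suc m) s) has_vector_derivative
      of_nat (Suc m) * (of_nat (Suc (Suc m)) * a (Suc (Suc m)))) (at t within S)"
      by (simp del: of_nat_Suc)
    from has_vector_derivative_mult_right[OF this, of "inverse (of_nat (Suc m))"]
    show ?thesis using Suc
      by (simp add: a_def mult.assoc[symmetric] del: exp_jet.simps of_nat_Suc)
  qed
qed

text \<open>What matters is that the bound is linear in \<open>x\<close>: this one factor is what
  later compensates the large constant \<open>D\<close>. The closed form at 1/2 controls the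
  remaining series.\<close>

lemma sum_arith_geometric_le:
  fixes x :: real
  assumes "0 \<le> x" "x \<le> 1/2"
  shows "(\<Sum>k\<le>n. real (Suc k) * x ^ Suc k) \<le> 4 * x"
proof -
  have half: "(\<Sum>k\<le>n. real (Suc k) * (1/2) ^ k) = 4 - (real n + 3) * (1/2) ^ n"
    by (induction n) (auto simp: field_simps)
  have "(\<Sum>k\<le>n. real (Suc k) * x ^ Suc k) = x * (\<Sum>k\<le>n. real (Suc k) * x ^ k)"
    by (simp add: sum_distrib_left mult_ac)
  also have "\<dots> \<le> x * (\<Sum>k\<le>n. real (Suc k) * (1/2) ^ k)"
    using assms by (intro mult_left_mono sum_mono power_mono) auto
  also have "\<dots> \<le> x * 4"
    unfolding half using assms by (intro mult_left_mono) auto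
  finally show ?thesis by simp
qed

text \<open>The recursion yields n |a_n| r^n \<le> K times a bound for all earlier |a_j| r^j. A step
  can therefore enlarge the bound only while n < K, and then by at most the factor 1 + K. After
  about K steps the division by n stops the growth, so the bound is uniform in n.\<close>

lemma exp_jet_bound:
  assumes g: "\<And>k. \<bar>g (Suc k) t\<bar> \<le> D * s ^ Suc k"
    and D: "0 \<le> D" and s: "0 \<le> s" and r: "0 \<le> r" "r * s \<le> 1/2"
    and K: "4 * D * (r * s) \<le> K" "0 \<le> K"
  shows "r ^ n * norm (exp_jet g n t) \<le> (1 + K) ^ min n (nat \<lceil>K\<rceil>)"
proof (induction n rule: less_induct)
  case (less n)
  show ?case
  proof (cases n)
    case 0
    then show ?thesis by simp
  next
    case (Suc m)
    let ?m = "nat \<lceil>K\<rceil>"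
    let ?B = "(1 + K) ^ min m ?m"
    have IH: "r ^ (m - k) * norm (exp_jet g (m - k) t) \<le> ?B" for k
    proof -
      have "r ^ (m - k) * norm (exp_jet g (m - k) t) \<le> (1 + K) ^ min (m - k) ?m"
        using less.IH[of "m - k"] Suc by simp
      also have "\<dots> \<le> ?B" using K(2) by (intro power_increasing) auto
      finally show ?thesis .
    qed
    have "real (Suc m) * norm (exp_jet g (Suc m) t)
        = norm (\<Sum>k\<le>m. \<i> * of_real (real (Suc k) * g (Suc k) t) * exp_jet g (m - k) t)"
      by (simp add: norm_divide del: of_nat_Suc)
    also have "\<dots> \<le> (\<Sum>k\<le>m. real (Suc k) * \<bar>g (Suc k) t\<bar> * norm (exp_jet g (m - k) t))"
      by (rule sum_norm_le) (simp add: norm_mult abs_mult del: of_nat_Suc)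
    finally have "r ^ Suc m * (real (Suc m) * norm (exp_jet g (Suc m) t))
        \<le> r ^ Suc m * (\<Sum>k\<le>m. real (Suc k) * \<bar>g (Suc k) t\<bar> * norm (exp_jet g (m - k) t))"
      using r by (intro mult_left_mono) auto
    also have "\<dots> = (\<Sum>k\<le>m. real (Suc k) * (r ^ Suc k * \<bar>g (Suc k) t\<bar>) *
        (r ^ (m - k) * norm (exp_jet g (m - k) t)))"
      unfolding sum_distrib_left
    proof (intro sum.cong refl)
      fix k assume "k \<in> {..m}"
      then have "r ^ Suc m = r ^ Suc k * r ^ (m - k)"
        by (simp add: power_add[symmetric])
      then show "r ^ Suc m * (real (Suc k) * \<bar>g (Suc k) t\<bar> * norm (exp_jet g (m - k) t))
         = real (Suc k) * (r ^ Suc k * \<bar>g (Suc k) t\<bar>) * (r ^ (m - k) * norm (exp_jet g (m - k) t))"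
        by (simp only: mult_ac)
    qed
    also have "\<dots> \<le> (\<Sum>k\<le>m. real (Suc k) * (r ^ Suc k * (D * s ^ Suc k)) * ?B)"
      using r D s g IH by (intro sum_mono mult_mono) auto
    also have "\<dots> = D * (\<Sum>k\<le>m. real (Suc k) * (r * s) ^ Suc k) * ?B"
      unfolding sum_distrib_left sum_distrib_right power_mult_distrib
      by (intro sum.cong) (auto simp: mult_ac)
    also have "\<dots> \<le> D * (4 * (r * s)) * ?B"
      using D r s K by (intro mult_right_mono mult_left_mono sum_arith_geometric_le) auto
    also have "\<dots> \<le> K * ?B"
      using K by (intro mult_right_mono) (auto simp: mult_ac)
    finally have *: "real (Suc m) * (r ^ Suc m * norm (exp_jet g (Suc m) t)) \<le> K * ?B"
      by (simp add: mult_ac)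
    \<comment> \<open>Up to the threshold the exponent of 1 + K increases by one and the factor
      \<open>real (Suc m)\<close> is wasted. Beyond it \<open>K \<le> real (Suc m)\<close>, and the
      previous bound simply persists.\<close>
    show ?thesis
    proof (cases "m < ?m")
      case True
      have "K * ?B \<le> (1 + K) ^ min n ?m" using True K Suc by (simp add: algebra_simps)
      also have "\<dots> \<le> real (Suc m) * (1 + K) ^ min n ?m" using K by (simp add: algebra_simps)
      finally have "real (Suc m) * (r ^ Suc m * norm (exp_jet g (Suc m) t))
          \<le> real (Suc m) * (1 + K) ^ min n ?m" using * by linarith
      then show ?thesis unfolding Suc by (rule mult_left_le_imp_le) simp
    next
      case False
      then have "K \<le> real (Suc m)" by linarith
      then have "K * ?B \<le> real (Suc m) * ?B" using K by (intro mult_right_mono) auto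
      then have "real (Suc m) * (r ^ Suc m * norm (exp_jet g (Suc m) t)) \<le> real (Suc m) * ?B"
        using * by linarith
      then have "r ^ Suc m * norm (exp_jet g (Suc m) t) \<le> ?B"
        by (rule mult_left_le_imp_le) simp
      moreover have "min m ?m = min (Suc m) ?m" using False by simp
      ultimately show ?thesis unfolding Suc by (simp only:)
    qed
  qed
qed

subsection \<open>Lagrange polynomials of the Chebyshev grid\<close>

lemma fact_ge_power_div_exp: "real n ^ n / exp (real n) \<le> fact n"
proof -
  have "(\<Sum>k\<in>{n}. inverse (fact k) * real n ^ k) \<le> (\<Sum>k. inverse (fact k) * real n ^ k)"
    using summable_exp[of "real n"] by (intro sum_le_suminf) auto
  also have "\<dots> = exp (real n)" by (simp add: exp_def)
  finally show ?thesis by (simp add: field_simps)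
qed

text \<open>The difference is twice the product of the sines of the half sum and the half
  difference. The half sum keeps a distance of at least |x - y| / 2 from both 0 and pi, so Jordan's
  inequality applies to both sines. The square reflects that the cosine is flat at 0 and pi, where
  the Chebyshev nodes cluster.\<close>

lemma abs_cos_diff_ge:
  assumes "0 \<le> x" "x \<le> pi" "0 \<le> y" "y \<le> pi"
  shows "2 * ((x - y) / pi)\<^sup>2 \<le> \<bar>cos x - cos y\<bar>"
  using assms
proof (induction x y rule: linorder_wlog)
  case (le x y)
  let ?d = "(y - x) / 2"
  \<comment> \<open>Jordan's inequality: the concave sine lies above its chord over
    [0, pi/2].\<close>
  have jordan: "2 * u / pi \<le> sin u" if u: "0 \<le> u" "u \<le> pi / 2" for u :: real
  proof -
    have "concave_on {0..pi/2} sin"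
      by (rule f''_le0_imp_concave[where f' = cos and f'' = "\<lambda>x. - sin x"])
        (auto intro!: derivative_eq_intros sin_ge_zero)
    from concave_onD[OF this, of "2 * u / pi" 0 "pi / 2"] u show ?thesis
      by (simp add: field_simps)
  qed
  have sin_ge: "2 * ?d / pi \<le> sin z" if z: "?d \<le> z" "z \<le> pi - ?d" for z
  proof (cases "z \<le> pi / 2")
    case True
    have "2 * ?d / pi \<le> 2 * z / pi" using z by (intro divide_right_mono) auto
    also have "\<dots> \<le> sin z" using z le True by (intro jordan) auto
    finally show ?thesis .
  next
    case False
    have "2 * ?d \<le> 2 * (pi - z)" using z by argo
    then have "2 * ?d / pi \<le> 2 * (pi - z) / pi" by (rule divide_right_mono) simp
    also have "\<dots> \<le> sin (pi - z)" using z le False by (intro jordan) (auto simp: field_simps)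
    finally show ?thesis by simp
  qed
  have "\<bar>cos x - cos y\<bar> = 2 * (\<bar>sin ((x + y) / 2)\<bar> * \<bar>sin ?d\<bar>)"
    by (simp add: cos_diff_cos abs_mult)
  also have "\<dots> \<ge> 2 * ((2 * ?d / pi) * (2 * ?d / pi))"
    using le order_trans[OF sin_ge[of "(x + y) / 2"] abs_ge_self]
      order_trans[OF sin_ge[of ?d] abs_ge_self]
    by (intro mult_left_mono mult_mono) (auto simp: field_simps)
  finally show ?case
    using le by (simp add: power2_eq_square minus_mult_minus field_simps)
next
  case (sym x y)
  have "((x - y) / pi)\<^sup>2 = ((y - x) / pi)\<^sup>2"
    by (simp add: power_divide power2_commute)
  with sym show ?case by (simp add: abs_minus_commute)
qed

lemma cheb_node_diff_ge:
  assumes "2 \<le> q" "i < q" "j < q"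
  shows "((real i - real j) / (real q - 1))\<^sup>2 \<le> \<bar>cheb_node q i - cheb_node q j\<bar>"
proof -
  let ?a = "\<lambda>i. real i * pi / (real q - 1)"
  have a: "0 \<le> ?a i" "?a i \<le> pi" if "i < q" for i
  proof -
    have "real i \<le> real q - 1" "0 < real q - 1" using assms that by auto
    then show "0 \<le> ?a i" "?a i \<le> pi"
      by (auto simp: pos_divide_le_eq mult.commute[of pi] intro: mult_right_mono)
  qed
  have "(real i - real j) / (real q - 1) = (?a i - ?a j) / pi"
    by (simp add: diff_divide_distrib)
  moreover have "\<bar>cheb_node q i - cheb_node q j\<bar> = \<bar>cos (?a i) - cos (?a j)\<bar> / 2"
    by (simp add: cheb_node_def flip: diff_divide_distrib)
  ultimately show ?thesis
    using abs_cos_diff_ge[OF a[OF assms(2)] a[OF assms(3)]] by simp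
qed

lemma prod_dist_nat:
  assumes "i \<le> n"
  shows "(\<Prod>j\<in>{..n} - {i}. \<bar>real i - real j\<bar>) = fact i * fact (n - i)"
proof -
  have "(\<Prod>j\<in>{..n} - {i}. \<bar>real i - real j\<bar>)
      = (\<Prod>j\<in>{0..<i}. \<bar>real i - real j\<bar>) * (\<Prod>j\<in>{Suc i..<Suc n}. \<bar>real i - real j\<bar>)"
    using assms by (subst prod.union_disjoint[symmetric]) (auto intro!: prod.cong)
  also have "(\<Prod>j\<in>{0..<i}. \<bar>real i - real j\<bar>) = fact i"
    by (auto simp: fact_prod_rev of_nat_diff intro!: prod.cong)
  also have "(\<Prod>j\<in>{Suc i..<Suc n}. \<bar>real i - real j\<bar>) = (\<Prod>k\<in>{0..<n - i}. real (Suc k))"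
    using assms by (intro prod.reindex_bij_witness[of _ "\<lambda>k. k + Suc i" "\<lambda>j. j - Suc i"]) auto
  also have "\<dots> = fact (n - i)" by (simp add: fact_prod_Suc)
  finally show ?thesis .
qed

text \<open>The product of |i - j| / n over the other nodes is i! (n - i)! / n^n, where n = q - 1.
  This is at least n! / (2 n)^n, hence at least (2 e)^-n and so 6^-n because e < 3. The quadratic
  lower bound on the node distances squares it, which gives the base 36.\<close>

lemma prod_cheb_node_diff_ge:
  assumes q: "2 \<le> q" and i: "i < q"
  shows "(1 / 36) ^ q \<le> (\<Prod>j\<in>{..<q} - {i}. \<bar>cheb_node q i - cheb_node q j\<bar>)"
proof -
  define n where "n = q - 1"
  have n: "q = Suc n" "0 < n" "i \<le> n" "real q - 1 = real n" using q i by (auto simp: n_def)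
  have "fact n = fact i * fact (n - i) * real (n choose i)"
    using binomial_fact_lemma[OF n(3)] by (metis of_nat_fact of_nat_mult)
  also have "\<dots> \<le> fact i * fact (n - i) * real (2 ^ n)"
    by (intro mult_left_mono) (auto simp del: of_nat_power intro: binomial_le_pow2)
  finally have 1: "fact n / 2 ^ n \<le> (fact i * fact (n - i) :: real)"
    by (simp add: field_simps)
  have e3: "exp (real n) \<le> 3 ^ n"
    using power_mono[of "exp 1" "3 :: real" n] e_less_272 exp_of_nat_mult[of n "1 :: real"] by simp
  have "(1 / 6) ^ n = 1 / (3 ^ n * 2 ^ n :: real)"
    by (simp add: power_mult_distrib[symmetric] power_divide)
  also have "\<dots> \<le> 1 / (exp (real n) * 2 ^ n)"
    using e3 by (intro divide_left_mono mult_right_mono) auto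
  also have "\<dots> = real n ^ n / exp (real n) / 2 ^ n / real n ^ n"
    using n by simp
  also have "\<dots> \<le> fact n / 2 ^ n / real n ^ n"
    by (intro divide_right_mono fact_ge_power_div_exp) auto
  also have "\<dots> \<le> fact i * fact (n - i) / real n ^ n"
    by (intro divide_right_mono 1) auto
  also have "\<dots> = (\<Prod>j\<in>{..n} - {i}. \<bar>real i - real j\<bar> / real n)"
    using n by (simp add: prod_dividef prod_dist_nat)
  finally have "((1 / 6) ^ n)\<^sup>2 \<le> (\<Prod>j\<in>{..n} - {i}. \<bar>real i - real j\<bar> / real n)\<^sup>2"
    by (intro power_mono) auto
  also have "\<dots> = (\<Prod>j\<in>{..<q} - {i}. ((real i - real j) / (real q - 1))\<^sup>2)"
    unfolding n(4) unfolding n(1) lessThan_Suc_atMost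
    by (simp add: prod_power_distrib power_divide)
  also have "\<dots> \<le> (\<Prod>j\<in>{..<q} - {i}. \<bar>cheb_node q i - cheb_node q j\<bar>)"
    using q i by (intro prod_mono conjI cheb_node_diff_ge) auto
  finally have "((1 / 6) ^ n)\<^sup>2 \<le> (\<Prod>j\<in>{..<q} - {i}. \<bar>cheb_node q i - cheb_node q j\<bar>)" .
  moreover have "((1 / 6) ^ n)\<^sup>2 = (1 / 36 :: real) ^ n"
    by (simp add: power2_eq_square flip: power_mult_distrib)
  moreover have "(1 / 36) ^ q \<le> (1 / 36 :: real) ^ n"
    unfolding n(1) by (rule power_decreasing) auto
  ultimately show ?thesis by linarith
qed

lemma abs_cheb_node_le: "\<bar>cheb_node q i\<bar> \<le> 1 / 2"
  using abs_cos_le_one by (simp add: cheb_node_def)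

lemma inj_on_cheb_node:
  assumes "2 \<le> q"
  shows "inj_on (cheb_node q) {..<q}"
proof (rule inj_onI)
  fix i j assume "i \<in> {..<q}" "j \<in> {..<q}" "cheb_node q i = cheb_node q j"
  then show "i = j"
    using cheb_node_diff_ge[of q i j] assms by (auto simp: power2_eq_square zero_le_mult_iff
        mult_le_0_iff divide_le_0_iff)
qed

text \<open>Both \<open>t\<close> and the nodes lie in an interval of length \<open>w\<close>, so
  each numerator is at most \<open>w\<close>, and \<open>w\<close> cancels against the scaling of
  the denominators. An exponential bound is good enough, since the radius in the coefficient
  estimates is chosen large enough to beat its base.\<close>

lemma lagrange_poly_cheb_bound:
  assumes q: "2 \<le> q" and i: "i < q" and w: "0 < w" and t: "t \<in> {c - w / 2..c + w / 2}"
  shows "\<bar>lagrange_poly q (\<lambda>i. c + w * cheb_node q i) i t\<bar> \<le> 36 ^ q"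
proof -
  let ?J = "{..<q} - {i}" and ?z = "cheb_node q"
  let ?P = "\<Prod>j\<in>?J. \<bar>?z i - ?z j\<bar>"
  have t1: "\<bar>t - (c + w * ?z j)\<bar> \<le> w" for j
  proof -
    have "\<bar>w * ?z j\<bar> \<le> w * (1 / 2)"
      using w abs_cheb_node_le by (simp only: abs_mult) (intro mult_mono, auto)
    then show ?thesis using t by (auto simp: abs_le_iff)
  qed
  have P: "(1 / 36) ^ q \<le> ?P" by (rule prod_cheb_node_diff_ge[OF q i])
  then have P0: "0 < ?P" by (smt (verit) zero_less_power divide_pos_pos)
  \<comment> \<open>Multiplying by the product of distances, instead of dividing, lets each factor
    be compared with 1 even when a distance is formally zero.\<close>
  have "\<bar>lagrange_poly q (\<lambda>i. c + w * ?z i) i t\<bar> * ?P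
      = (\<Prod>j\<in>?J. \<bar>t - (c + w * ?z j)\<bar> / (w * \<bar>?z i - ?z j\<bar>) * \<bar>?z i - ?z j\<bar>)"
    unfolding prod.distrib using w
    by (simp add: lagrange_poly_def abs_prod abs_mult flip: right_diff_distrib)
  also have "\<dots> \<le> (\<Prod>j\<in>?J. 1)"
  proof (intro prod_mono conjI)
    fix j assume "j \<in> ?J"
    show "\<bar>t - (c + w * ?z j)\<bar> / (w * \<bar>?z i - ?z j\<bar>) * \<bar>?z i - ?z j\<bar> \<le> 1"
      using t1[of j] w by (cases "?z i = ?z j") auto
  qed (use w in auto)
  finally have "\<bar>lagrange_poly q (\<lambda>i. c + w * ?z i) i t\<bar> * ?P \<le> 1" by simp
  then have "\<bar>lagrange_poly q (\<lambda>i. c + w * ?z i) i t\<bar> * (1 / 36) ^ q \<le> 1"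
    using mult_left_mono[OF P, of "\<bar>lagrange_poly q (\<lambda>i. c + w * ?z i) i t\<bar>"] by linarith
  then show ?thesis by (simp add: power_divide)
qed

subsection \<open>Interpolation of oscillatory functions on a square\<close>

text \<open>The interval has length \<open>w\<close> and the coefficients decay with radius
  \<open>144 * w\<close>, so \<open>w ^ q\<close> cancels and the error depends on \<open>w\<close>,
  \<open>D\<close> and \<open>s\<close> only through \<open>K\<close>.\<close>

lemma oscillatory_interpolation_error:
  fixes g :: "nat \<Rightarrow> real \<Rightarrow> real" and c w :: real
  defines "I \<equiv> {c - w / 2..c + w / 2}"
  assumes g: "\<And>k t. t \<in> I \<Longrightarrow> (g k has_real_derivative real (Suc k) * g (Suc k) t) (at t within I)"
    and bound: "\<And>k t. t \<in> I \<Longrightarrow> \<bar>g (Suc k) t\<bar> \<le> D * s ^ Suc k"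
    and D: "0 \<le> D" and s: "0 \<le> s" and w: "0 < w" "144 * w * s \<le> 1 / 2"
    and K: "4 * D * (144 * w * s) \<le> K" "0 \<le> K" and q: "2 \<le> q" and t: "t \<in> I"
  shows "norm (cis (g 0 t) - (\<Sum>i<q. cis (g 0 (c + w * cheb_node q i)) *
      of_real (lagrange_poly q (\<lambda>i. c + w * cheb_node q i) i t)))
    \<le> 2 * (1 + K) ^ nat \<lceil>K\<rceil> / 144 ^ q"
proof -
  let ?f = "\<lambda>k t. fact k * exp_jet g k t"
  let ?M = "(1 + K) ^ nat \<lceil>K\<rceil> / (144 * w) ^ q"
  have "norm (?f 0 t - (\<Sum>i<q. ?f 0 (c + w * cheb_node q i) *
      of_real (lagrange_poly q (\<lambda>i. c + w * cheb_node q i) i t)))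
    \<le> 2 * ?M * ((c + w / 2) - (c - w / 2)) ^ q"
  proof (rule lagrange_interpolation_error)
    show "(?f k has_vector_derivative ?f (Suc k) t) (at t within {c - w / 2..c + w / 2})"
      if "t \<in> {c - w / 2..c + w / 2}" for k t
      using has_vector_derivative_mult_right[OF exp_jet_derivative[OF g], of t "fact k" k] that
      by (simp add: I_def mult_ac del: exp_jet.simps)
    show "norm (?f q t) \<le> fact q * ?M" if "t \<in> {c - w / 2..c + w / 2}" for t
    proof -
      have "(144 * w) ^ q * norm (exp_jet g q t) \<le> (1 + K) ^ min q (nat \<lceil>K\<rceil>)"
        using that w by (intro exp_jet_bound[OF bound D s _ _ K]) (auto simp: I_def)
      also have "\<dots> \<le> (1 + K) ^ nat \<lceil>K\<rceil>" using K by (intro power_increasing) auto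
      finally show ?thesis using w by (simp add: norm_mult field_simps)
    qed
    show "inj_on (\<lambda>i. c + w * cheb_node q i) {..<q}"
      using inj_on_cheb_node[OF q] w by (auto simp: inj_on_def)
    show "c + w * cheb_node q i \<in> {c - w / 2..c + w / 2}" for i
    proof -
      have "w * \<bar>cheb_node q i\<bar> \<le> w * (1 / 2)"
        using w abs_cheb_node_le by (intro mult_left_mono) auto
      then have "\<bar>w * cheb_node q i\<bar> \<le> w / 2" using w by (simp add: abs_mult)
      then show ?thesis by (auto simp: abs_le_iff)
    qed
  qed (use t in \<open>auto simp: I_def\<close>)
  then show ?thesis using w by (simp add: power_mult_distrib)
qed

text \<open>Interpolate in the second variable first, then replace each slice through a node
  \<open>\<zeta>' j\<close> by its interpolant in the first variable. The errors of the slices enter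
  weighted by \<open>b j\<close>, which costs q times their bound.\<close>

lemma tensor_interpolation_error:
  fixes f :: "real \<Rightarrow> real \<Rightarrow> complex"
  assumes v: "norm (f u v - (\<Sum>j<q. f u (\<zeta>' j) * of_real (b j))) \<le> E"
    and u: "\<And>j. j < q \<Longrightarrow> norm (f u (\<zeta>' j) - (\<Sum>i<q. f (\<zeta> i) (\<zeta>' j) * of_real (a i))) \<le> E"
    and b: "\<And>j. j < q \<Longrightarrow> \<bar>b j\<bar> \<le> \<Lambda>"
  shows "norm (f u v - (\<Sum>t\<in>{..<q} \<times> {..<q}. f (\<zeta> (fst t)) (\<zeta>' (snd t)) * of_real (a (fst t) * b (snd t))))
    \<le> E * (1 + real q * \<Lambda>)"
proof -
  let ?e = "\<lambda>j. f u (\<zeta>' j) - (\<Sum>i<q. f (\<zeta> i) (\<zeta>' j) * of_real (a i))"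
  have "(\<Sum>t\<in>{..<q} \<times> {..<q}. f (\<zeta> (fst t)) (\<zeta>' (snd t)) * of_real (a (fst t) * b (snd t)))
      = (\<Sum>i<q. \<Sum>j<q. f (\<zeta> i) (\<zeta>' j) * of_real (a i * b j))"
    by (simp add: sum.cartesian_product split_beta)
  also have "\<dots> = (\<Sum>j<q. (\<Sum>i<q. f (\<zeta> i) (\<zeta>' j) * of_real (a i)) * of_real (b j))"
    by (subst sum.swap) (simp add: sum_distrib_left mult_ac)
  finally have "f u v - (\<Sum>t\<in>{..<q} \<times> {..<q}. f (\<zeta> (fst t)) (\<zeta>' (snd t)) * of_real (a (fst t) * b (snd t)))
      = (f u v - (\<Sum>j<q. f u (\<zeta>' j) * of_real (b j))) + (\<Sum>j<q. ?e j * of_real (b j))"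
    by (simp add: left_diff_distrib sum_subtractf)
  also have "norm \<dots> \<le> E + (\<Sum>j<q. E * \<Lambda>)"
  proof (intro norm_triangle_mono v order_trans[OF norm_sum sum_mono])
    fix j assume "j \<in> {..<q}"
    then show "norm (?e j * of_real (b j)) \<le> E * \<Lambda>"
      unfolding norm_mult norm_of_real
      using u[of j] b[of j] by (intro mult_mono) (auto intro: order_trans[OF norm_ge_zero])
  qed
  finally show ?thesis by (simp add: algebra_simps)
qed

lemma box_interpolation_error:
  fixes \<phi> :: "point \<Rightarrow> real" and g h :: "nat \<Rightarrow> point \<Rightarrow> real" and a b w :: real
  defines "I \<equiv> {a - w / 2..a + w / 2}" and "J \<equiv> {b - w / 2..b + w / 2}"
  assumes g0: "g 0 = \<phi>" and h0: "h 0 = \<phi>"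
    and g: "\<And>k u v. u \<in> I \<Longrightarrow> v \<in> J \<Longrightarrow>
      ((\<lambda>u. g k (u, v)) has_real_derivative real (Suc k) * g (Suc k) (u, v)) (at u within I)"
    and h: "\<And>k u v. u \<in> I \<Longrightarrow> v \<in> J \<Longrightarrow>
      ((\<lambda>v. h k (u, v)) has_real_derivative real (Suc k) * h (Suc k) (u, v)) (at v within J)"
    and gD: "\<And>k u v. u \<in> I \<Longrightarrow> v \<in> J \<Longrightarrow> \<bar>g (Suc k) (u, v)\<bar> \<le> D * s ^ Suc k"
    and hD: "\<And>k u v. u \<in> I \<Longrightarrow> v \<in> J \<Longrightarrow> \<bar>h (Suc k) (u, v)\<bar> \<le> D * s ^ Suc k"
    and D: "0 \<le> D" and s: "0 \<le> s" and w: "0 < w" "144 * w * s \<le> 1 / 2"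
    and K: "4 * D * (144 * w * s) \<le> K" "0 \<le> K" and q: "2 \<le> q"
    and p: "p \<in> region (Square (a, b) w)"
  shows "norm (cis (\<phi> p) - (\<Sum>t\<in>{..<q} \<times> {..<q}.
      cis (\<phi> (cheb_grid q (Square (a, b) w) t)) * of_real (lagrange_poly2 q (Square (a, b) w) t p)))
    \<le> 4 * (1 + K) ^ nat \<lceil>K\<rceil> / 2 ^ q"
proof -
  obtain u v where uv: "p = (u, v)" "u \<in> I" "v \<in> J"
    using p by (cases p) (auto simp: region_def I_def J_def cbox_Pair_eq)
  define B where "B = (1 + K) ^ nat \<lceil>K\<rceil>"
  have B: "1 \<le> B" using K by (simp add: B_def)
  let ?x = "\<lambda>i. a + w * cheb_node q i" and ?y = "\<lambda>i. b + w * cheb_node q i"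
  have yJ: "?y j \<in> J" for j
  proof -
    have "w * \<bar>cheb_node q j\<bar> \<le> w * (1 / 2)"
      using w abs_cheb_node_le by (intro mult_left_mono) auto
    then have "\<bar>w * cheb_node q j\<bar> \<le> w / 2" using w by (simp add: abs_mult)
    then show ?thesis by (auto simp: J_def abs_le_iff)
  qed
  have "norm (cis (\<phi> (u, v)) - (\<Sum>t\<in>{..<q} \<times> {..<q}. cis (\<phi> (?x (fst t), ?y (snd t))) *
      of_real (lagrange_poly q ?x (fst t) u * lagrange_poly q ?y (snd t) v)))
    \<le> 2 * B / 144 ^ q * (1 + real q * 36 ^ q)"
  proof (rule tensor_interpolation_error[where f = "\<lambda>u v. cis (\<phi> (u, v))"])
    show "norm (cis (\<phi> (u, v)) - (\<Sum>j<q. cis (\<phi> (u, ?y j)) * of_real (lagrange_poly q ?y j v)))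
        \<le> 2 * B / 144 ^ q"
      using oscillatory_interpolation_error[of b w "\<lambda>k v. h k (u, v)" D s K q v]
        h[OF uv(2)] hD[OF uv(2)] D s w K q uv h0 by (simp add: J_def B_def)
    show "norm (cis (\<phi> (u, ?y j)) - (\<Sum>i<q. cis (\<phi> (?x i, ?y j)) * of_real (lagrange_poly q ?x i u)))
        \<le> 2 * B / 144 ^ q" for j
      using oscillatory_interpolation_error[of a w "\<lambda>k u. g k (u, ?y j)" D s K q u]
        g[OF _ yJ] gD[OF _ yJ] D s w K q uv g0 by (simp add: I_def B_def)
    show "\<bar>lagrange_poly q ?y j v\<bar> \<le> 36 ^ q" if "j < q" for j
      using lagrange_poly_cheb_bound[OF q that w(1)] uv by (simp add: J_def)
  qed
  \<comment> \<open>Here q \<le> 2^q turns q 36^q into 72^q, and 144 = 2 * 72 leaves the decay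
    2^-q.\<close>
  also have "\<dots> \<le> 2 * B / 144 ^ q * (72 ^ q + 72 ^ q)"
  proof (intro mult_left_mono add_mono)
    have "real q * 36 ^ q \<le> 2 ^ q * 36 ^ q"
      using less_exp[of q] by (intro mult_right_mono) (simp_all add: of_nat_le_numeral_power_cancel_iff)
    then show "real q * 36 ^ q \<le> 72 ^ q" by (simp flip: power_mult_distrib)
  qed (use B in auto)
  also have "\<dots> = 4 * B / 2 ^ q"
  proof -
    have "(144 :: real) ^ q = 2 ^ q * 72 ^ q" by (simp flip: power_mult_distrib)
    then show ?thesis by simp
  qed
  finally show ?thesis
    by (simp add: uv cheb_grid_def lagrange_poly2_def B_def)
qed

subsection \<open>Partial derivatives within a box\<close>

lemma smooth_within_continuous_on: "smooth_within f S \<Longrightarrow> continuous_on S f"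
  by (metis smooth_within_def k_times_cont_diff_on.simps(1))

lemma smooth_within_differentiable_on: "smooth_within f S \<Longrightarrow> f differentiable_on S"
  by (metis smooth_within_def k_times_cont_diff_on.simps(2))

lemma smooth_within_partial:
  "smooth_within f S \<Longrightarrow> b \<in> Basis \<Longrightarrow> smooth_within (partial_within S b f) S"
  by (metis smooth_within_def k_times_cont_diff_on.simps(2))

lemma smooth_within_partial_funpow:
  "smooth_within f S \<Longrightarrow> b \<in> Basis \<Longrightarrow> smooth_within ((partial_within S b ^^ n) f) S"
  by (induction n) (auto intro: smooth_within_partial)

text \<open>\<open>frechet_derivative\<close> chooses some map satisfying
  \<open>has_derivative\<close>. Two functions that agree on \<open>S\<close> satisfy it with the
  same maps, hence receive the same choice.\<close>

lemma partial_within_cong: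
  assumes "\<And>y. y \<in> S \<Longrightarrow> f y = g y" "z \<in> S"
  shows "partial_within S b f z = partial_within S b g z"
proof -
  have "(f has_derivative D) (at z within S) \<longleftrightarrow> (g has_derivative D) (at z within S)" for D
    using assms by (metis has_derivative_transform)
  then show ?thesis by (simp add: partial_within_def frechet_derivative_def)
qed

text \<open>This passes from Frechet derivatives within a set to ordinary derivatives in one
  variable, to which mean value arguments apply. Since \<open>T\<close> may be a closed interval,
  end points on the boundary of \<open>S\<close> are covered.\<close>

lemma partial_within_line:
  assumes f: "f differentiable_on S" and T: "t \<in> T" "\<And>s. s \<in> T \<Longrightarrow> z + s *\<^sub>R b \<in> S"
  shows "((\<lambda>s. f (z + s *\<^sub>R b)) has_real_derivative partial_within S b f (z + t *\<^sub>R b)) (at t within T)"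
proof -
  let ?D = "frechet_derivative f (at (z + t *\<^sub>R b) within S)"
  have D: "(f has_derivative ?D) (at (z + t *\<^sub>R b) within S)"
    using f T by (auto simp: differentiable_on_def frechet_derivative_works)
  have "((\<lambda>s. z + s *\<^sub>R b) has_derivative (\<lambda>s. s *\<^sub>R b)) (at t within T)"
    by (auto intro!: derivative_eq_intros)
  moreover have "(f has_derivative ?D) (at (z + t *\<^sub>R b) within (\<lambda>s. z + s *\<^sub>R b) ` T)"
    by (rule has_derivative_subset[OF D]) (use T in auto)
  ultimately have "((\<lambda>s. f (z + s *\<^sub>R b)) has_derivative (\<lambda>s. ?D (s *\<^sub>R b))) (at t within T)"
    by (rule has_derivative_in_compose)
  moreover have "?D (s *\<^sub>R b) = ?D b * s" for s
    using linear_scale[OF has_derivative_linear[OF D]] by simp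
  ultimately show ?thesis
    by (simp add: has_field_derivative_def partial_within_def)
qed

text \<open>The mean value theorem is used twice: in \<open>s\<close> for the difference of
  \<open>f\<close> between the levels \<open>t2\<close> and \<open>t1\<close>, then in
  \<open>t\<close> for the \<open>b\<close>-derivative that results.\<close>

lemma double_difference_mean_value:
  assumes f: "f differentiable_on S" and df: "partial_within S b f differentiable_on S"
    and s: "s1 < s2" and t: "t1 < t2"
    and S: "\<And>s t. s \<in> {s1..s2} \<Longrightarrow> t \<in> {t1..t2} \<Longrightarrow> z + s *\<^sub>R b + t *\<^sub>R b' \<in> S"
  shows "\<exists>s\<in>{s1..s2}. \<exists>t\<in>{t1..t2}.
    f (z + s2 *\<^sub>R b + t2 *\<^sub>R b') - f (z + s1 *\<^sub>R b + t2 *\<^sub>R b')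
      - f (z + s2 *\<^sub>R b + t1 *\<^sub>R b') + f (z + s1 *\<^sub>R b + t1 *\<^sub>R b')
    = (s2 - s1) * (t2 - t1) * partial_within S b' (partial_within S b f) (z + s *\<^sub>R b + t *\<^sub>R b')"
proof -
  let ?g = "partial_within S b f" and ?p = "\<lambda>s t. z + s *\<^sub>R b + t *\<^sub>R b'"
  have ds: "((\<lambda>s. f (?p s t)) has_real_derivative ?g (?p s t)) (at s within {s1..s2})"
    if "s \<in> {s1..s2}" "t \<in> {t1..t2}" for s t
    using partial_within_line[OF f, of s "{s1..s2}" "z + t *\<^sub>R b'" b] S that
    by (simp add: add_ac)
  have dt: "((\<lambda>t. ?g (?p s t)) has_real_derivative partial_within S b' ?g (?p s t)) (at t within {t1..t2})"
    if "s \<in> {s1..s2}" "t \<in> {t1..t2}" for s t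
    using partial_within_line[OF df, of t "{t1..t2}" "z + s *\<^sub>R b" b'] S that by simp
  have "\<exists>s\<in>{s1<..<s2}. (f (?p s2 t2) - f (?p s2 t1)) - (f (?p s1 t2) - f (?p s1 t1))
      = (*) (?g (?p s t2) - ?g (?p s t1)) (s2 - s1)"
    using s t by (intro mvt_simple)
      (auto intro!: DERIV_diff ds simp flip: has_field_derivative_def)
  then obtain s where s': "s \<in> {s1<..<s2}" "(f (?p s2 t2) - f (?p s2 t1)) - (f (?p s1 t2) - f (?p s1 t1))
      = (?g (?p s t2) - ?g (?p s t1)) * (s2 - s1)"
    by blast
  have "\<exists>t\<in>{t1<..<t2}. ?g (?p s t2) - ?g (?p s t1) = (*) (partial_within S b' ?g (?p s t)) (t2 - t1)"
    using s' t by (intro mvt_simple) (auto intro!: dt simp flip: has_field_derivative_def)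
  then obtain t where t': "t \<in> {t1<..<t2}"
      "?g (?p s t2) - ?g (?p s t1) = partial_within S b' ?g (?p s t) * (t2 - t1)"
    by blast
  have "f (?p s2 t2) - f (?p s1 t2) - f (?p s2 t1) + f (?p s1 t1)
      = (s2 - s1) * (t2 - t1) * partial_within S b' ?g (?p s t)"
    using s'(2)[unfolded t'(2)] by (simp add: algebra_simps)
  moreover have "s \<in> {s1..s2}" "t \<in> {t1..t2}" using s'(1) t'(1) by auto
  ultimately show ?thesis by blast
qed

text \<open>On a closed box the argument of Schwarz also works at boundary points, since the small rectangle
  used for the double difference may have \<open>z\<close> on its boundary.\<close>

lemma partial_within_commute:
  fixes l u :: "'a::euclidean_space"
  defines "S \<equiv> cbox l u"
  assumes f: "smooth_within f S" and b: "b \<in> Basis" "b' \<in> Basis"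
    and z: "z \<in> S" and lu: "\<And>i. i \<in> Basis \<Longrightarrow> l \<bullet> i < u \<bullet> i"
  shows "partial_within S b (partial_within S b' f) z = partial_within S b' (partial_within S b f) z"
proof (cases "b = b'")
  case False
  let ?F = "partial_within S b' (partial_within S b f)" and ?G = "partial_within S b (partial_within S b' f)"
  let ?p = "\<lambda>s t. z + s *\<^sub>R b + t *\<^sub>R b'"
  have "\<bar>?F z - ?G z\<bar> \<le> e" if e: "e > 0" for e
  proof -
    have "continuous_on S ?F" "continuous_on S ?G"
      by (intro smooth_within_continuous_on smooth_within_partial f b)+
    then have cont: "\<exists>d>0. \<forall>y\<in>S. dist y z < d \<longrightarrow> dist (?F y) (?F z) < e / 2"
      "\<exists>d>0. \<forall>y\<in>S. dist y z < d \<longrightarrow> dist (?G y) (?G z) < e / 2"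
      using z half_gt_zero[OF e] unfolding continuous_on_iff by blast+
    obtain d1 where d1: "d1 > 0" "\<And>y. y \<in> S \<Longrightarrow> dist y z < d1 \<Longrightarrow> dist (?F y) (?F z) < e / 2"
      using cont(1) by blast
    obtain d2 where d2: "d2 > 0" "\<And>y. y \<in> S \<Longrightarrow> dist y z < d2 \<Longrightarrow> dist (?G y) (?G z) < e / 2"
      using cont(2) by blast
    \<comment> \<open>Two coordinates move by at most \<open>d\<close> each, so the rectangle stays
      within 2d < min d1 d2 of \<open>z\<close>. Clipping it to the box leaves positive side lengths
      because \<open>l\<close> is strictly below \<open>u\<close>.\<close>
    define d where "d = min d1 d2 / 3"
    have d0: "d > 0" using d1 d2 by (simp add: d_def)
    define s1 s2 t1 t2 where st: "s1 = max (- d) (l \<bullet> b - z \<bullet> b)" "s2 = min d (u \<bullet> b - z \<bullet> b)"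
      "t1 = max (- d) (l \<bullet> b' - z \<bullet> b')" "t2 = min d (u \<bullet> b' - z \<bullet> b')"
    have zb: "l \<bullet> i \<le> z \<bullet> i" "z \<bullet> i \<le> u \<bullet> i" if "i \<in> Basis" for i
      using z that by (auto simp: S_def mem_box)
    have lt: "s1 < s2" "t1 < t2"
      using zb[OF b(1)] zb[OF b(2)] lu[OF b(1)] lu[OF b(2)] d0 by (auto simp: st)
    have pS: "?p s t \<in> S" if "s \<in> {s1..s2}" "t \<in> {t1..t2}" for s t
      unfolding S_def mem_box
    proof
      fix i :: 'a assume i: "i \<in> Basis"
      show "l \<bullet> i \<le> ?p s t \<bullet> i \<and> ?p s t \<bullet> i \<le> u \<bullet> i"
        using that zb[OF i] b i False
        by (auto simp: inner_add_left inner_Basis st)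
    qed
    have near: "dist (?p s t) z < d1" "dist (?p s t) z < d2" if "s \<in> {s1..s2}" "t \<in> {t1..t2}" for s t
    proof -
      have "dist (?p s t) z \<le> norm (s *\<^sub>R b) + norm (t *\<^sub>R b')"
        unfolding dist_norm by (rule order_trans[OF _ norm_triangle_ineq]) simp
      also have "\<dots> = \<bar>s\<bar> + \<bar>t\<bar>" using b by simp
      also have "\<dots> \<le> d + d" using that zb[OF b(1)] zb[OF b(2)] d0 by (auto simp: st)
      also have "\<dots> < 3 * d" using d0 by simp
      also have "\<dots> = min d1 d2" by (simp add: d_def)
      finally show "dist (?p s t) z < d1" "dist (?p s t) z < d2" by auto
    qed
    have diff: "f differentiable_on S" "partial_within S b f differentiable_on S"
      "partial_within S b' f differentiable_on S"
      by (intro smooth_within_differentiable_on smooth_within_partial f b)+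
    let ?\<Delta> = "f (?p s2 t2) - f (?p s1 t2) - f (?p s2 t1) + f (?p s1 t1)"
    obtain s t where st1: "s \<in> {s1..s2}" "t \<in> {t1..t2}"
      "?\<Delta> = (s2 - s1) * (t2 - t1) * ?F (?p s t)"
      using double_difference_mean_value[OF diff(1,2) lt pS] by blast
    have swap: "z + t *\<^sub>R b' + s *\<^sub>R b = ?p s t" for s t by (simp add: add_ac)
    obtain s' t' where st2: "s' \<in> {s1..s2}" "t' \<in> {t1..t2}"
      "f (?p s2 t2) - f (?p s2 t1) - f (?p s1 t2) + f (?p s1 t1) = (t2 - t1) * (s2 - s1) * ?G (?p s' t')"
      using double_difference_mean_value[OF diff(1,3) lt(2,1), of z b] pS unfolding swap by blast
    have "(s2 - s1) * (t2 - t1) * ?F (?p s t) = (s2 - s1) * (t2 - t1) * ?G (?p s' t')"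
      using st1(3) st2(3)[unfolded mult.commute[of "t2 - t1" "s2 - s1"]] by linarith
    \<comment> \<open>One double difference, divided by the nonzero area of the rectangle, is a
      value of each of the two mixed derivatives. The two points may differ, but both lie close to
      \<open>z\<close>.\<close>
    then have "?F (?p s t) = ?G (?p s' t')" using lt by simp
    then show ?thesis
      using d1(2)[OF pS[OF st1(1,2)] near(1)[OF st1(1,2)]]
        d2(2)[OF pS[OF st2(1,2)] near(2)[OF st2(1,2)]]
      unfolding dist_real_def by argo
  qed
  then have "\<bar>?F z - ?G z\<bar> \<le> 0" by (rule field_le_epsilon) auto
  then show ?thesis by simp
qed simp

text \<open>\<open>mixed_partial\<close> applies the \<open>p\<close>-derivatives before the
  \<open>x\<close>-derivatives. For interpolation in \<open>x\<close>, a single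
  \<open>p\<close>-derivative comes after many \<open>x\<close>-derivatives and has to be moved
  inside.\<close>

lemma partial_within_funpow_commute:
  fixes l u :: "'a::euclidean_space"
  defines "S \<equiv> cbox l u"
  assumes f: "smooth_within f S" and b: "b \<in> Basis" "b' \<in> Basis"
    and lu: "\<And>i. i \<in> Basis \<Longrightarrow> l \<bullet> i < u \<bullet> i" and z: "z \<in> S"
  shows "partial_within S b' ((partial_within S b ^^ n) f) z = (partial_within S b ^^ n) (partial_within S b' f) z"
  using z
proof (induction n arbitrary: z)
  case (Suc n)
  have "partial_within S b' (partial_within S b ((partial_within S b ^^ n) f)) z
      = partial_within S b (partial_within S b' ((partial_within S b ^^ n) f)) z"
    unfolding S_def using smooth_within_partial_funpow[OF f b(1)] b lu Suc.prems
    by (intro partial_within_commute) (auto simp: S_def)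
  also have "\<dots> = partial_within S b ((partial_within S b ^^ n) (partial_within S b' f)) z"
    by (rule partial_within_cong[OF Suc.IH Suc.prems])
  finally show ?case by simp
qed simp

subsection \<open>Taylor coefficients of the phase\<close>

lemma unit_square_Pair: "(u, v) \<in> unit_square \<longleftrightarrow> u \<in> {0..1} \<and> v \<in> {0..1}"
  by (simp add: unit_square_def cbox_Pair_eq)

lemma unit_square_Times_eq_cbox:
  "unit_square \<times> unit_square = cbox ((0, 0), (0, 0)) ((1, 1), (1 :: real, 1 :: real))"
  by (simp add: unit_square_def cbox_Pair_eq)

text \<open>\<open>V k x p\<close> and \<open>W k x p\<close> are the Taylor coefficients $\partial_{p_1}^k U / k!$ and
  $\partial_{p_2}^k U / k!$. No mixed derivatives in \<open>p\<close> are needed, because the tensor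
  product interpolation error splits into two one-dimensional errors.\<close>

definition analytic_increments :: "(point \<Rightarrow> point \<Rightarrow> real) \<Rightarrow> real \<Rightarrow> real \<Rightarrow> bool" where
  "analytic_increments U Q s \<longleftrightarrow> (\<exists>V W. V 0 = U \<and> W 0 = U \<and>
    (\<forall>k. \<forall>x\<in>unit_square. \<forall>u\<in>{0..1}. \<forall>v\<in>{0..1}.
      ((\<lambda>u. V k x (u, v)) has_real_derivative real (Suc k) * V (Suc k) x (u, v)) (at u within {0..1}) \<and>
      ((\<lambda>v. W k x (u, v)) has_real_derivative real (Suc k) * W (Suc k) x (u, v)) (at v within {0..1})) \<and>
    (\<forall>k. \<forall>x\<in>unit_square. \<forall>x'\<in>unit_square. \<forall>p\<in>unit_square.
      \<bar>V k x p - V k x' p\<bar> \<le> Q * s ^ k * (\<bar>fst x - fst x'\<bar> + \<bar>snd x - snd x'\<bar>) \<and>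
      \<bar>W k x p - W k x' p\<bar> \<le> Q * s ^ k * (\<bar>fst x - fst x'\<bar> + \<bar>snd x - snd x'\<bar>)))"

lemma increment_bound_unit_square:
  fixes f :: "point \<Rightarrow> real"
  assumes d1: "\<And>u v. u \<in> {0..1} \<Longrightarrow> v \<in> {0..1} \<Longrightarrow>
      ((\<lambda>u. f (u, v)) has_real_derivative f1 (u, v)) (at u within {0..1})"
    and d2: "\<And>u v. u \<in> {0..1} \<Longrightarrow> v \<in> {0..1} \<Longrightarrow>
      ((\<lambda>v. f (u, v)) has_real_derivative f2 (u, v)) (at v within {0..1})"
    and bound: "\<And>x. x \<in> unit_square \<Longrightarrow> \<bar>f1 x\<bar> \<le> M" "\<And>x. x \<in> unit_square \<Longrightarrow> \<bar>f2 x\<bar> \<le> M"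
    and x: "x \<in> unit_square" "x' \<in> unit_square"
  shows "\<bar>f x - f x'\<bar> \<le> M * (\<bar>fst x - fst x'\<bar> + \<bar>snd x - snd x'\<bar>)"
proof -
  obtain u v u' v' where uv: "x = (u, v)" "x' = (u', v')" by (cases x, cases x') auto
  then have mem: "u \<in> {0..1}" "v \<in> {0..1}" "u' \<in> {0..1}" "v' \<in> {0..1}"
    using x by (auto simp: unit_square_Pair)
  have "norm (f (u, v) - f (u', v)) \<le> M * norm (u - u')"
    by (rule field_differentiable_bound[of "{0..1}" "\<lambda>u. f (u, v)" "\<lambda>u. f1 (u, v)"])
      (use d1 bound(1) mem in \<open>auto simp: unit_square_Pair\<close>)
  moreover have "norm (f (u', v) - f (u', v')) \<le> M * norm (v - v')"
    by (rule field_differentiable_bound[of "{0..1}" "\<lambda>v. f (u', v)" "\<lambda>v. f2 (u', v)"])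
      (use d2 bound(2) mem in \<open>auto simp: unit_square_Pair\<close>)
  ultimately show ?thesis by (simp add: uv algebra_simps)
qed

lemma partial_within_unit_squares:
  fixes F :: "point \<times> point \<Rightarrow> real"
  defines "S \<equiv> unit_square \<times> unit_square"
  assumes F: "F differentiable_on S" and y: "y \<in> unit_square" and uv: "u \<in> {0..1}" "v \<in> {0..1}"
  shows "((\<lambda>u. F (y, (u, v))) has_real_derivative partial_within S ((0, 0), (1, 0)) F (y, (u, v))) (at u within {0..1})"
    and "((\<lambda>v. F (y, (u, v))) has_real_derivative partial_within S ((0, 0), (0, 1)) F (y, (u, v))) (at v within {0..1})"
    and "((\<lambda>u. F ((u, v), y)) has_real_derivative partial_within S ((1, 0), (0, 0)) F ((u, v), y)) (at u within {0..1})"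
    and "((\<lambda>v. F ((u, v), y)) has_real_derivative partial_within S ((0, 1), (0, 0)) F ((u, v), y)) (at v within {0..1})"
  using partial_within_line[OF F uv(1), of "(y, (0, v))" "((0, 0), (1, 0))"]
    partial_within_line[OF F uv(2), of "(y, (u, 0))" "((0, 0), (0, 1))"]
    partial_within_line[OF F uv(1), of "((0, v), y)" "((1, 0), (0, 0))"]
    partial_within_line[OF F uv(2), of "((u, 0), y)" "((0, 1), (0, 0))"] y uv
  by (auto simp: S_def unit_square_Pair simp flip: zero_prod_def)

lemma jointly_real_analytic_increments:
  assumes "jointly_real_analytic \<Psi>"
  obtains Q s where "0 < Q" "0 < s" "analytic_increments \<Psi> Q s"
    "analytic_increments (\<lambda>p x. \<Psi> x p) Q s"
proof -
  define S where "S = unit_square \<times> unit_square"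
  define F where "F = (\<lambda>(x, p). \<Psi> x p)"
  let ?D = "partial_within S"
  define e1 e2 e3 e4 :: "point \<times> point"
    where e: "e1 = ((1, 0), (0, 0))" "e2 = ((0, 1), (0, 0))" "e3 = ((0, 0), (1, 0))" "e4 = ((0, 0), (0, 1))"
  obtain Q R where QR: "Q > 0" "R > 0" and smooth: "smooth_within F S"
    and bd: "\<And>i j x p. x \<in> unit_square \<Longrightarrow> p \<in> unit_square \<Longrightarrow>
      \<bar>mixed_partial i j \<Psi> x p\<bar> \<le> Q * mi_fact i * mi_fact j * (1 / R) ^ (mi_abs i + mi_abs j)"
    using assms unfolding jointly_real_analytic_def F_def S_def by blast
  have Basis: "e1 \<in> Basis" "e2 \<in> Basis" "e3 \<in> Basis" "e4 \<in> Basis"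
    by (auto simp: e Basis_prod_def zero_prod_def)
  define s where "s = 1 / R"
  have s0: "s > 0" using QR by (simp add: s_def)
  define T where "T e k = (\<lambda>z. (?D e ^^ k) F z / fact k)" for e k
  have diff: "(?D e ^^ k) F differentiable_on S" if "e \<in> Basis" for e k
    by (intro smooth_within_differentiable_on smooth_within_partial_funpow smooth that)
  have step: "?D e ((?D e ^^ k) F) z / fact k = real (Suc k) * T e (Suc k) z" for e k z
    by (simp add: T_def divide_simps)
  have commute: "?D b' ((?D b ^^ n) F) z = (?D b ^^ n) (?D b' F) z"
    if "b \<in> Basis" "b' \<in> Basis" "z \<in> S" for b b' n z
    unfolding S_def unit_square_Times_eq_cbox
  proof (rule partial_within_funpow_commute)
    show "((0, 0), (0, 0)) \<bullet> i < ((1, 1), (1 :: real, 1 :: real)) \<bullet> i" if "i \<in> Basis" for i :: "point \<times> point"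
      using that by (auto simp: Basis_prod_def zero_prod_def)
  qed (use that smooth in \<open>auto simp: S_def unit_square_Times_eq_cbox\<close>)
  \<comment> \<open>Only one derivative falls on the other variable, and 1! = 1. The analytic bound
    Q k! R^(-k-1), divided by k!, is therefore (Q s) s^k with s = 1 / R.\<close>
  have bound: "\<bar>?D b' ((?D b ^^ k) F) z / fact k\<bar> \<le> (Q * s) * s ^ k"
    if z: "z \<in> S" and bb: "b \<in> {e1, e2} \<and> b' \<in> {e3, e4} \<or> b \<in> {e3, e4} \<and> b' \<in> {e1, e2}" for b b' k z
  proof -
    obtain x p where xp: "z = (x, p)" "x \<in> unit_square" "p \<in> unit_square"
      using z by (auto simp: S_def)
    have mp: "mixed_partial i j \<Psi> x p =
      (?D e1 ^^ fst i) ((?D e2 ^^ snd i) ((?D e3 ^^ fst j) ((?D e4 ^^ snd j) F))) z" for i j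
      by (simp add: mixed_partial_def Let_def S_def e F_def xp)
    have "\<exists>i j. ?D b' ((?D b ^^ k) F) z = mixed_partial i j \<Psi> x p \<and>
        mi_fact i * mi_fact j = fact k \<and> mi_abs i + mi_abs j = Suc k"
    proof -
      consider "b = e1" "b' = e3" | "b = e1" "b' = e4" | "b = e2" "b' = e3" | "b = e2" "b' = e4"
        | "b = e3" "b' = e1" | "b = e3" "b' = e2" | "b = e4" "b' = e1" | "b = e4" "b' = e2"
        using bb by blast
      then show ?thesis
      proof cases
        case 1 then show ?thesis using commute[OF Basis(1,3) z, of k]
          by (intro exI[of _ "(k, 0)"] exI[of _ "(1, 0)"]) (simp add: mp mi_fact_def mi_abs_def)
      next
        case 2 then show ?thesis using commute[OF Basis(1,4) z, of k]
          by (intro exI[of _ "(k, 0)"] exI[of _ "(0, 1)"]) (simp add: mp mi_fact_def mi_abs_def)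
      next
        case 3 then show ?thesis using commute[OF Basis(2,3) z, of k]
          by (intro exI[of _ "(0, k)"] exI[of _ "(1, 0)"]) (simp add: mp mi_fact_def mi_abs_def)
      next
        case 4 then show ?thesis using commute[OF Basis(2,4) z, of k]
          by (intro exI[of _ "(0, k)"] exI[of _ "(0, 1)"]) (simp add: mp mi_fact_def mi_abs_def)
      next
        case 5 then show ?thesis
          by (intro exI[of _ "(1, 0)"] exI[of _ "(k, 0)"]) (simp add: mp mi_fact_def mi_abs_def)
      next
        case 6 then show ?thesis
          by (intro exI[of _ "(0, 1)"] exI[of _ "(k, 0)"]) (simp add: mp mi_fact_def mi_abs_def)
      next
        case 7 then show ?thesis
          by (intro exI[of _ "(1, 0)"] exI[of _ "(0, k)"]) (simp add: mp mi_fact_def mi_abs_def)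
      next
        case 8 then show ?thesis
          by (intro exI[of _ "(0, 1)"] exI[of _ "(0, k)"]) (simp add: mp mi_fact_def mi_abs_def)
      qed
    qed
    then obtain i j where ij: "?D b' ((?D b ^^ k) F) z = mixed_partial i j \<Psi> x p"
      "mi_fact i * mi_fact j = fact k" "mi_abs i + mi_abs j = Suc k" by blast
    show ?thesis
      using bd[OF xp(2,3), of i j] ij by (simp add: s_def abs_divide mult.assoc field_simps)
  qed
  \<comment> \<open>Both orders of the variables are treated at once: \<open>\<iota>\<close> pairs
    the arguments, \<open>b\<close> and \<open>b'\<close> are the directions of the second argument,
    which carries the Taylor expansion, and \<open>c\<close> and \<open>c'\<close> those of the
    first, along which increments are taken.\<close>
  have half: "analytic_increments (\<lambda>y p. F (\<iota> y p)) (Q * s) s"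
    if \<iota>: "\<And>y p. y \<in> unit_square \<Longrightarrow> p \<in> unit_square \<Longrightarrow> \<iota> y p \<in> S"
      and bb: "b \<in> {e1, e2} \<and> b' \<in> {e1, e2} \<and> c \<in> {e3, e4} \<and> c' \<in> {e3, e4} \<or>
        b \<in> {e3, e4} \<and> b' \<in> {e3, e4} \<and> c \<in> {e1, e2} \<and> c' \<in> {e1, e2}"
      and d: "\<And>G y u v. G differentiable_on S \<Longrightarrow> y \<in> unit_square \<Longrightarrow> u \<in> {0..1} \<Longrightarrow> v \<in> {0..1} \<Longrightarrow>
          ((\<lambda>u. G (\<iota> y (u, v))) has_real_derivative ?D b G (\<iota> y (u, v))) (at u within {0..1})"
        "\<And>G y u v. G differentiable_on S \<Longrightarrow> y \<in> unit_square \<Longrightarrow> u \<in> {0..1} \<Longrightarrow> v \<in> {0..1} \<Longrightarrow>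
          ((\<lambda>v. G (\<iota> y (u, v))) has_real_derivative ?D b' G (\<iota> y (u, v))) (at v within {0..1})"
        "\<And>G p u v. G differentiable_on S \<Longrightarrow> p \<in> unit_square \<Longrightarrow> u \<in> {0..1} \<Longrightarrow> v \<in> {0..1} \<Longrightarrow>
          ((\<lambda>u. G (\<iota> (u, v) p)) has_real_derivative ?D c G (\<iota> (u, v) p)) (at u within {0..1})"
        "\<And>G p u v. G differentiable_on S \<Longrightarrow> p \<in> unit_square \<Longrightarrow> u \<in> {0..1} \<Longrightarrow> v \<in> {0..1} \<Longrightarrow>
          ((\<lambda>v. G (\<iota> (u, v) p)) has_real_derivative ?D c' G (\<iota> (u, v) p)) (at v within {0..1})"
    for \<iota> b b' c c'
    unfolding analytic_increments_def
  proof (rule exI[of _ "\<lambda>k y p. T b k (\<iota> y p)"], rule exI[of _ "\<lambda>k y p. T b' k (\<iota> y p)"],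
      intro conjI allI ballI)
    have bB: "b \<in> Basis" "b' \<in> Basis" using bb Basis by blast+
    fix k :: nat and y :: point and u v :: real
    assume mem: "y \<in> unit_square" "u \<in> {0..1}" "v \<in> {0..1}"
    show "((\<lambda>u. T b k (\<iota> y (u, v))) has_real_derivative real (Suc k) * T b (Suc k) (\<iota> y (u, v))) (at u within {0..1})"
      unfolding step[symmetric] unfolding T_def by (intro DERIV_cdivide d(1) diff bB mem)
    show "((\<lambda>v. T b' k (\<iota> y (u, v))) has_real_derivative real (Suc k) * T b' (Suc k) (\<iota> y (u, v))) (at v within {0..1})"
      unfolding step[symmetric] unfolding T_def by (intro DERIV_cdivide d(2) diff bB mem)
  next
    fix k :: nat and y y' p :: point
    assume mem: "y \<in> unit_square" "y' \<in> unit_square" "p \<in> unit_square"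
    have *: "\<bar>T a k (\<iota> y p) - T a k (\<iota> y' p)\<bar> \<le> Q * s * s ^ k * (\<bar>fst y - fst y'\<bar> + \<bar>snd y - snd y'\<bar>)"
      if a: "a \<in> {b, b'}" for a
    proof (rule increment_bound_unit_square[where f = "\<lambda>y. T a k (\<iota> y p)"])
      have aB: "a \<in> Basis" using a bb Basis by blast
      fix u v :: real assume uv: "u \<in> {0..1}" "v \<in> {0..1}"
      show "((\<lambda>u. T a k (\<iota> (u, v) p)) has_real_derivative ?D c ((?D a ^^ k) F) (\<iota> (u, v) p) / fact k) (at u within {0..1})"
        unfolding T_def by (intro DERIV_cdivide d(3) diff aB mem uv)
      show "((\<lambda>v. T a k (\<iota> (u, v) p)) has_real_derivative ?D c' ((?D a ^^ k) F) (\<iota> (u, v) p) / fact k) (at v within {0..1})"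
        unfolding T_def by (intro DERIV_cdivide d(4) diff aB mem uv)
    next
      fix y :: point assume "y \<in> unit_square"
      then have "\<iota> y p \<in> S" by (rule \<iota>[OF _ mem(3)])
      then show "\<bar>?D c ((?D a ^^ k) F) (\<iota> y p) / fact k\<bar> \<le> Q * s * s ^ k"
        "\<bar>?D c' ((?D a ^^ k) F) (\<iota> y p) / fact k\<bar> \<le> Q * s * s ^ k"
        using a bb by (intro bound; blast)+
    qed (use mem in auto)
    show "\<bar>T b k (\<iota> y p) - T b k (\<iota> y' p)\<bar> \<le> Q * s * s ^ k * (\<bar>fst y - fst y'\<bar> + \<bar>snd y - snd y'\<bar>)"
      "\<bar>T b' k (\<iota> y p) - T b' k (\<iota> y' p)\<bar> \<le> Q * s * s ^ k * (\<bar>fst y - fst y'\<bar> + \<bar>snd y - snd y'\<bar>)"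
      using * by auto
  qed (auto simp: T_def)
  note lines = partial_within_unit_squares[folded S_def e]
  have "analytic_increments (\<lambda>x p. F (x, p)) (Q * s) s"
    by (rule half[of _ e3 e4 e1 e2]) (auto simp: S_def[symmetric] intro!: lines, auto simp: S_def)
  moreover have "analytic_increments (\<lambda>p x. F (x, p)) (Q * s) s"
    by (rule half[of _ e1 e2 e3 e4]) (auto simp: S_def[symmetric] intro!: lines, auto simp: S_def)
  ultimately show thesis using that[of "Q * s" s] QR s0 by (simp add: F_def)
qed

subsection \<open>The residual kernel\<close>

lemma quadtree_facts:
  assumes "A \<in> quadtree N"
  shows "0 < width A" "region A \<subseteq> unit_square" "center A \<in> unit_square"
proof -
  obtain l m n where A: "A = Square ((real m + 1/2) / 2 ^ l, (real n + 1/2) / 2 ^ l) (1 / 2 ^ l)"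
    and mn: "m < 2 ^ l" "n < 2 ^ l"
    using assms by (auto simp: quadtree_def)
  have le: "0 \<le> (real i + 1/2) / 2 ^ l - 1 / 2 ^ l / 2" "(real i + 1/2) / 2 ^ l + 1 / 2 ^ l / 2 \<le> 1"
    if "i < 2 ^ l" for i
  proof -
    have "real (i + 1) \<le> real (2 ^ l)" using that by (subst of_nat_le_iff) simp
    moreover have "(real i + 1/2) / 2 ^ l + 1 / 2 ^ l / 2 = (real i + 1) / 2 ^ l"
      by (simp add: field_simps)
    ultimately show "(real i + 1/2) / 2 ^ l + 1 / 2 ^ l / 2 \<le> 1"
      by (simp add: divide_le_eq)
    show "0 \<le> (real i + 1/2) / 2 ^ l - 1 / 2 ^ l / 2"
      by (simp add: field_simps)
  qed
  show "0 < width A" by (simp add: A)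
  show "region A \<subseteq> unit_square"
    using le[OF mn(1)] le[OF mn(2)]
    by (auto simp: A region_def unit_square_def cbox_Pair_eq)
  moreover have "center A \<in> region A"
    by (simp add: A region_def cbox_Pair_eq)
  ultimately show "center A \<in> unit_square" by blast
qed

lemma region_dist_center:
  assumes "x \<in> region A"
  shows "\<bar>fst x - fst (center A)\<bar> + \<bar>snd x - snd (center A)\<bar> \<le> width A"
proof -
  obtain a b where ab: "center A = (a, b)" by (cases "center A")
  show ?thesis
    using assms by (cases x) (auto simp: region_def ab cbox_Pair_eq)
qed

lemma residual_kernel_eq_cis:
  "residual_kernel \<Psi> N A B x p = cis (2 * pi * real N * residual_phase \<Psi> A B x p)"
  by (simp add: residual_kernel_def cis_conv_exp mult_ac)

text \<open>The residual is symmetric under exchanging the variables together with their boxes, so a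
  single interpolation estimate covers both claims.\<close>

lemma residual_kernel_swap:
  "residual_kernel \<Psi> N A B x p = residual_kernel (\<lambda>p x. \<Psi> x p) N B A p x"
  by (simp add: residual_kernel_def residual_phase_def algebra_simps)

lemma residual_kernel_interpolation_error:
  assumes U: "analytic_increments U Q s" and Qs: "0 \<le> Q" "0 < s"
    and AB: "A \<in> quadtree N" "B \<in> quadtree N" "width A * width B = 1 / real N"
    and small: "288 * width B * s \<le> 1" and N: "0 < N" and q: "2 \<le> q"
    and x: "x \<in> region A" and p: "p \<in> region B"
  defines "K \<equiv> 1152 * pi * Q * s"
  shows "norm (residual_kernel U N A B x p - (\<Sum>t\<in>{..<q} \<times> {..<q}.
      residual_kernel U N A B x (cheb_grid q B t) * of_real (lagrange_poly2 q B t p)))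
    \<le> 4 * (1 + K) ^ nat \<lceil>K\<rceil> / 2 ^ q"
proof -
  obtain a b w where B: "B = Square (a, b) w" by (cases B) auto
  note fA = quadtree_facts[OF AB(1)] and fB = quadtree_facts[OF AB(2), unfolded B square.sel]
  have xs: "x \<in> unit_square" using x fA by auto
  let ?I = "{a - w / 2..a + w / 2}" and ?J = "{b - w / 2..b + w / 2}"
  have reg: "region (Square (a, b) w) = ?I \<times> ?J"
    by (simp add: region_def cbox_Pair_eq)
  have "(a - w / 2, b - w / 2) \<in> ?I \<times> ?J" "(a + w / 2, b + w / 2) \<in> ?I \<times> ?J"
    using fB(1) by auto
  then have "(a - w / 2, b - w / 2) \<in> unit_square" "(a + w / 2, b + w / 2) \<in> unit_square"
    using fB(2) unfolding reg by blast+
  then have IJ: "?I \<subseteq> {0..1}" "?J \<subseteq> {0..1}"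
    by (auto simp: unit_square_Pair)
  obtain V W where V0: "V 0 = U" and W0: "W 0 = U"
    and dV: "\<And>k x u v. x \<in> unit_square \<Longrightarrow> u \<in> {0..1} \<Longrightarrow> v \<in> {0..1} \<Longrightarrow>
      ((\<lambda>u. V k x (u, v)) has_real_derivative real (Suc k) * V (Suc k) x (u, v)) (at u within {0..1})"
    and dW: "\<And>k x u v. x \<in> unit_square \<Longrightarrow> u \<in> {0..1} \<Longrightarrow> v \<in> {0..1} \<Longrightarrow>
      ((\<lambda>v. W k x (u, v)) has_real_derivative real (Suc k) * W (Suc k) x (u, v)) (at v within {0..1})"
    and iV: "\<And>k x x' p. x \<in> unit_square \<Longrightarrow> x' \<in> unit_square \<Longrightarrow> p \<in> unit_square \<Longrightarrow>
      \<bar>V k x p - V k x' p\<bar> \<le> Q * s ^ k * (\<bar>fst x - fst x'\<bar> + \<bar>snd x - snd x'\<bar>)"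
    and iW: "\<And>k x x' p. x \<in> unit_square \<Longrightarrow> x' \<in> unit_square \<Longrightarrow> p \<in> unit_square \<Longrightarrow>
      \<bar>W k x p - W k x' p\<bar> \<le> Q * s ^ k * (\<bar>fst x - fst x'\<bar> + \<bar>snd x - snd x'\<bar>)"
    using U unfolding analytic_increments_def by blast
  define \<kappa> where "\<kappa> = 2 * pi * real N"
  \<comment> \<open>With \<open>x\<close> fixed, the residual is the increment of \<open>U\<close>
    from \<open>center A\<close> to \<open>x\<close>, as a function of \<open>p\<close>, plus this
    constant. The constant enters the coefficient of order 0 alone, where no bound is
    required.\<close>
  define c where "c = U (center A) (center B) - U x (center B)"
  define jet where "jet Y k p = \<kappa> * (Y k x p - Y k (center A) p + (if k = 0 then c else 0))"
    for Y :: "nat \<Rightarrow> point \<Rightarrow> point \<Rightarrow> real" and k p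
  define \<phi> where "\<phi> p = \<kappa> * residual_phase U A B x p" for p
  have jet0: "jet V 0 = \<phi>" "jet W 0 = \<phi>"
    by (auto simp: jet_def \<phi>_def V0 W0 residual_phase_def c_def fun_eq_iff)
  have wA: "\<kappa> * width A = 2 * pi / w"
    using AB(3) fB(1) N by (simp add: \<kappa>_def B field_simps)
  have inc: "\<kappa> * \<bar>Y k x p - Y k (center A) p\<bar> \<le> 2 * pi * Q / w * s ^ k"
    if "\<bar>Y k x p - Y k (center A) p\<bar>
      \<le> Q * s ^ k * (\<bar>fst x - fst (center A)\<bar> + \<bar>snd x - snd (center A)\<bar>)"
    for Y :: "nat \<Rightarrow> point \<Rightarrow> point \<Rightarrow> real" and k p
  proof -
    have "\<bar>Y k x p - Y k (center A) p\<bar> \<le> Q * s ^ k * width A"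
      using Qs by (intro order_trans[OF that] mult_left_mono region_dist_center[OF x]) auto
    then have "\<kappa> * \<bar>Y k x p - Y k (center A) p\<bar> \<le> \<kappa> * (Q * s ^ k * width A)"
      by (rule mult_left_mono) (simp add: \<kappa>_def)
    also have "\<dots> = Q * s ^ k * (\<kappa> * width A)" by simp
    finally show ?thesis unfolding wA by (simp add: mult_ac)
  qed
  have "norm (cis (\<phi> p) - (\<Sum>t\<in>{..<q} \<times> {..<q}.
      cis (\<phi> (cheb_grid q (Square (a, b) w) t)) * of_real (lagrange_poly2 q (Square (a, b) w) t p)))
    \<le> 4 * (1 + K) ^ nat \<lceil>K\<rceil> / 2 ^ q"
  proof (rule box_interpolation_error[where g = "jet V" and h = "jet W"
        and D = "2 * pi * Q / w" and s = s])
    fix k u v assume uv: "u \<in> ?I" "v \<in> ?J"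
    then have uv1: "u \<in> {0..1}" "v \<in> {0..1}" "(u, v) \<in> unit_square"
      using IJ by (auto simp: unit_square_Pair)
    show "((\<lambda>u. jet V k (u, v)) has_real_derivative real (Suc k) * jet V (Suc k) (u, v)) (at u within ?I)"
      unfolding jet_def
      by (rule has_field_derivative_subset[OF _ IJ(1)])
        (use uv1 fA xs in \<open>auto intro!: derivative_eq_intros dV simp: algebra_simps\<close>)
    show "((\<lambda>v. jet W k (u, v)) has_real_derivative real (Suc k) * jet W (Suc k) (u, v)) (at v within ?J)"
      unfolding jet_def
      by (rule has_field_derivative_subset[OF _ IJ(2)])
        (use uv1 fA xs in \<open>auto intro!: derivative_eq_intros dW simp: algebra_simps\<close>)
    show "\<bar>jet V (Suc k) (u, v)\<bar> \<le> 2 * pi * Q / w * s ^ Suc k"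
      using inc[where Y = V and k = "Suc k" and p = "(u, v)", OF iV[OF xs fA(3) uv1(3)]] by (simp add: jet_def abs_mult \<kappa>_def)
    show "\<bar>jet W (Suc k) (u, v)\<bar> \<le> 2 * pi * Q / w * s ^ Suc k"
      using inc[where Y = W and k = "Suc k" and p = "(u, v)", OF iW[OF xs fA(3) uv1(3)]] by (simp add: jet_def abs_mult \<kappa>_def)
  next
    show "4 * (2 * pi * Q / w) * (144 * w * s) \<le> K" using fB(1) by (simp add: K_def)
  qed (use jet0 fB Qs small q p in \<open>auto simp: B K_def\<close>)
  then show ?thesis by (simp add: residual_kernel_eq_cis \<phi>_def \<kappa>_def B)
qed

section \<open>Separated form with q^2 terms, and the choice of the degree\<close>

lemma separated_approx_square_sum:
  assumes "\<And>x p. x \<in> S \<Longrightarrow> p \<in> T \<Longrightarrow>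
    norm (f x p - (\<Sum>t\<in>{..<q} \<times> {..<q}. \<alpha> t x * \<beta> t p)) \<le> \<epsilon>"
  shows "separated_approx (q^2) \<epsilon> S T f"
proof -
  \<comment> \<open>The pairs of node indices are numbered by their two digits in base
    \<open>q\<close>.\<close>
  let ?e = "\<lambda>n. (n div q, n mod q)"
  have "bij_betw ?e {..<q^2} ({..<q} \<times> {..<q})"
  proof (rule bij_betw_byWitness[where f' = "\<lambda>(i, j). i * q + j"])
    show "(\<lambda>(i, j). i * q + j) ` ({..<q} \<times> {..<q}) \<subseteq> {..<q^2}"
    proof clarsimp
      fix i j assume "i < q" "j < q"
      then have "i * q + j < (i + 1) * q" by simp
      also have "\<dots> \<le> q * q" using \<open>i < q\<close> by (intro mult_le_mono1) simp
      finally show "i * q + j < q\<^sup>2" by (simp add: power2_eq_square)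
    qed
    show "?e ` {..<q^2} \<subseteq> {..<q} \<times> {..<q}"
      by (auto simp: power2_eq_square less_mult_imp_div_less intro!: mod_less_divisor intro: gr0I)
  qed auto
  then have reindex: "(\<Sum>n<q^2. \<alpha> (?e n) x * \<beta> (?e n) p) = (\<Sum>t\<in>{..<q} \<times> {..<q}. \<alpha> t x * \<beta> t p)" for x p
    by (rule sum.reindex_bij_betw)
  show ?thesis
    unfolding separated_approx_def
    by (rule exI[of _ "\<lambda>n. \<alpha> (?e n)"], rule exI[of _ "\<lambda>n. \<beta> (?e n)"])
      (simp add: reindex assms)
qed

text \<open>Take q = 2 + k + m, where 2^m exceeds \<open>M\<close>, 2^k exceeds 1 / \<epsilon>, and
  the summand 2 secures q \<ge> 2. Since \<epsilon> \<le> 1/e makes the logarithm at least 1,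
  additive constants are absorbed into a multiple of it, and it is bounded by its square.\<close>

lemma exponential_degree_choice:
  fixes M :: real
  obtains C where "0 < C"
    and "\<And>\<epsilon>. 0 < \<epsilon> \<Longrightarrow> \<epsilon> \<le> exp (- 1) \<Longrightarrow> \<exists>q\<ge>2. real q \<le> C * (ln (1 / \<epsilon>))^2 \<and> M / 2 ^ q \<le> \<epsilon>"
proof -
  obtain m where m: "M < 2 ^ m" using real_arch_pow[of 2 M] by auto
  have "\<exists>q\<ge>2. real q \<le> (real m + 5) * (ln (1 / \<epsilon>))^2 \<and> M / 2 ^ q \<le> \<epsilon>"
    if \<epsilon>: "0 < \<epsilon>" "\<epsilon> \<le> exp (- 1)" for \<epsilon>
  proof -
    let ?L = "ln (1 / \<epsilon>)"
    \<comment> \<open>The factor 2 compensates ln 2 \<ge> 1/2, so that 2^k \<ge> exp(L) = 1 /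
      \<epsilon> for L = ln (1 / \<epsilon>).\<close>
    define k where "k = nat \<lceil>2 * ?L\<rceil>"
    have L: "1 \<le> ?L" using \<epsilon> ln_le_cancel_iff[of \<epsilon> "exp (- 1)"] by (simp add: ln_div)
    then have k: "2 * ?L \<le> real k" "real k \<le> 2 * ?L + 1"
      unfolding k_def by (auto simp: of_nat_ceiling)
    have "1 / 2 \<le> ln (2 :: real)" using ln2_ge_two_thirds by simp
    then have "?L \<le> real k * ln 2"
      using mult_mono[of "2 * ?L" "real k" "1 / 2" "ln 2"] k L by simp
    then have "exp ?L \<le> exp (real k * ln 2)" by simp
    then have ek: "1 / \<epsilon> \<le> 2 ^ k" using \<epsilon> by (simp add: exp_of_nat_mult)
    have "M / 2 ^ (2 + k + m) \<le> 2 ^ m / 2 ^ (2 + k + m)"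
      using m by (intro divide_right_mono) auto
    also have "\<dots> = 1 / (4 * 2 ^ k)" by (simp add: power_add)
    also have "\<dots> \<le> 1 / 2 ^ k" by (intro divide_left_mono) auto
    also have "\<dots> \<le> \<epsilon>" using ek \<epsilon> by (simp add: field_simps)
    finally have small: "M / 2 ^ (2 + k + m) \<le> \<epsilon>" .
    have "real (2 + k + m) \<le> 2 * ?L + 3 + real m" using k by simp
    also have "\<dots> \<le> (real m + 5) * ?L"
      using L mult_left_mono[OF L, of "real m"] by (simp add: algebra_simps)
    also have "\<dots> \<le> (real m + 5) * ?L^2"
      using L by (intro mult_left_mono) (auto simp: power2_eq_square)
    finally show ?thesis using small by (intro exI[of _ "2 + k + m"]) auto
  qed
  then show thesis by (intro that[of "real m + 5"]) auto
qed

theorem theorem3p3: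
  fixes \<Phi> \<Psi> :: "point \<Rightarrow> point \<Rightarrow> real"
  assumes "phase_function \<Phi>"
    and "\<Psi> = polar_phase \<Phi>"
    and "jointly_real_analytic \<Psi>"
  shows "\<exists>(\<epsilon>0::real) (N0::nat) (C::real). 0 < \<epsilon>0 \<and> \<epsilon>0 < 1 \<and> 0 < C \<and>
    (\<forall>\<epsilon>. 0 < \<epsilon> \<and> \<epsilon> \<le> \<epsilon>0 \<longrightarrow>
      (\<exists>q::nat. 2 \<le> q \<and> real q \<le> C * (ln (1 / \<epsilon>))^2 \<and> real (q^2) \<le> C^2 * (ln (1 / \<epsilon>))^4 \<and>
        (\<forall>(N::nat) A B. N0 \<le> N \<and> (\<exists>n. N = 2 ^ n) \<and> A \<in> quadtree N \<and> B \<in> quadtree N \<and>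
            width A * width B = 1 / real N \<longrightarrow>
          (width B \<le> 1 / sqrt (real N) \<longrightarrow>
            (\<forall>x\<in>region A. \<forall>p\<in>region B.
              norm (residual_kernel \<Psi> N A B x p -
                (\<Sum>t\<in>{..<q} \<times> {..<q}.
                  residual_kernel \<Psi> N A B x (cheb_grid q B t) *
                  of_real (lagrange_poly2 q B t p))) \<le> \<epsilon>) \<and>
            separated_approx (q^2) \<epsilon> (region A) (region B) (residual_kernel \<Psi> N A B)) \<and>
          (width A \<le> 1 / sqrt (real N) \<longrightarrow>
            (\<forall>x\<in>region A. \<forall>p\<in>region B.
              norm (residual_kernel \<Psi> N A B x p -
                (\<Sum>t\<in>{..<q} \<times> {..<q}.
                  of_real (lagrange_poly2 q A t x) *
                  residual_kernel \<Psi> N A B (cheb_grid q A t) p)) \<le> \<epsilon>) \<and>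
            separated_approx (q^2) \<epsilon> (region A) (region B) (residual_kernel \<Psi> N A B)))))"
proof -
  obtain Q s where Qs: "0 < Q" "0 < s" and P: "analytic_increments \<Psi> Q s"
    and X: "analytic_increments (\<lambda>p x. \<Psi> x p) Q s"
    using jointly_real_analytic_increments[OF assms(3)] by blast
  define K where "K = 1152 * pi * Q * s"
  define M where "M = 4 * (1 + K) ^ nat \<lceil>K\<rceil>"
  obtain C where C: "0 < C" and degree: "\<And>\<epsilon>. 0 < \<epsilon> \<Longrightarrow> \<epsilon> \<le> exp (- 1) \<Longrightarrow>
      \<exists>q\<ge>2. real q \<le> C * (ln (1 / \<epsilon>))^2 \<and> M / 2 ^ q \<le> \<epsilon>"
    using exponential_degree_choice by blast
  \<comment> \<open>This makes 288 s \<le> sqrt N for N \<ge> N0, so a box of width at most 1 / sqrt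
    N satisfies 144 w s \<le> 1/2. The summand 1 ensures N > 0.\<close>
  define N0 where "N0 = nat \<lceil>(288 * s)\<^sup>2\<rceil> + 1"
  have small: "288 * w * s \<le> 1" if "N0 \<le> N" "w \<le> 1 / sqrt (real N)" for N w
  proof -
    have N: "(288 * s)\<^sup>2 \<le> real N" "0 < N" using that(1) unfolding N0_def by linarith+
    have "288 * s \<le> sqrt (real N)" by (rule real_le_rsqrt[OF N(1)])
    have "288 * w * s \<le> 288 * (1 / sqrt (real N)) * s"
      using that(2) Qs by (intro mult_right_mono mult_left_mono) auto
    moreover have "288 * (1 / sqrt (real N)) * s \<le> 1"
      using \<open>288 * s \<le> sqrt (real N)\<close> N(2) by (simp add: field_simps)
    ultimately show ?thesis by linarith
  qed
  have errP: "norm (residual_kernel \<Psi> N A B x p - (\<Sum>t\<in>{..<q} \<times> {..<q}.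
      residual_kernel \<Psi> N A B x (cheb_grid q B t) * of_real (lagrange_poly2 q B t p))) \<le> M / 2 ^ q"
    if "N0 \<le> N" "A \<in> quadtree N" "B \<in> quadtree N" "width A * width B = 1 / real N"
      "width B \<le> 1 / sqrt (real N)" "2 \<le> q" "x \<in> region A" "p \<in> region B" for N A B q x p
    unfolding M_def K_def
    by (rule residual_kernel_interpolation_error[OF P _ Qs(2) that(2-4) small[OF that(1,5)] _ that(6-8)])
      (use Qs that(1) in \<open>auto simp: N0_def\<close>)
  have errX: "norm (residual_kernel \<Psi> N A B x p - (\<Sum>t\<in>{..<q} \<times> {..<q}.
      of_real (lagrange_poly2 q A t x) * residual_kernel \<Psi> N A B (cheb_grid q A t) p)) \<le> M / 2 ^ q"
    if "N0 \<le> N" "A \<in> quadtree N" "B \<in> quadtree N" "width A * width B = 1 / real N"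
      "width A \<le> 1 / sqrt (real N)" "2 \<le> q" "x \<in> region A" "p \<in> region B" for N A B q x p
    unfolding M_def K_def residual_kernel_swap[of \<Psi>] mult.commute[of "of_real _"]
    by (rule residual_kernel_interpolation_error[OF X _ Qs(2) that(3,2) _ small[OF that(1,5)] _ that(6,8,7)])
      (use Qs that(1,4) in \<open>auto simp: N0_def mult.commute\<close>)
  show ?thesis
  \<comment> \<open>The threshold exp(-1) is the one for which the degree was chosen.
    \<open>N0\<close> and \<open>C\<close> are fixed before \<open>\<epsilon>\<close>, and
    \<open>q\<close> before \<open>N\<close> and the boxes.\<close>
  proof (rule exI[of _ "exp (- 1)"], rule exI[of _ N0], rule exI[of _ C], intro conjI allI impI)
    fix \<epsilon> :: real assume \<epsilon>: "0 < \<epsilon> \<and> \<epsilon> \<le> exp (- 1)"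
    then obtain q where q: "2 \<le> q" "real q \<le> C * (ln (1 / \<epsilon>))^2" "M / 2 ^ q \<le> \<epsilon>"
      using degree by blast
    have "real (q^2) \<le> (C * (ln (1 / \<epsilon>))^2)^2"
      using power_mono[OF q(2), of 2] by simp
    then have q2: "real (q^2) \<le> C^2 * (ln (1 / \<epsilon>))^4"
      by (simp add: power_mult_distrib flip: power_mult)
    note errP' = order_trans[OF errP q(3)] and errX' = order_trans[OF errX q(3)]
    show "\<exists>q::nat. 2 \<le> q \<and> real q \<le> C * (ln (1 / \<epsilon>))^2 \<and> real (q^2) \<le> C^2 * (ln (1 / \<epsilon>))^4 \<and>
        (\<forall>(N::nat) A B. N0 \<le> N \<and> (\<exists>n. N = 2 ^ n) \<and> A \<in> quadtree N \<and> B \<in> quadtree N \<and>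
            width A * width B = 1 / real N \<longrightarrow>
          (width B \<le> 1 / sqrt (real N) \<longrightarrow>
            (\<forall>x\<in>region A. \<forall>p\<in>region B.
              norm (residual_kernel \<Psi> N A B x p -
                (\<Sum>t\<in>{..<q} \<times> {..<q}.
                  residual_kernel \<Psi> N A B x (cheb_grid q B t) *
                  of_real (lagrange_poly2 q B t p))) \<le> \<epsilon>) \<and>
            separated_approx (q^2) \<epsilon> (region A) (region B) (residual_kernel \<Psi> N A B)) \<and>
          (width A \<le> 1 / sqrt (real N) \<longrightarrow>
            (\<forall>x\<in>region A. \<forall>p\<in>region B.
              norm (residual_kernel \<Psi> N A B x p -
                (\<Sum>t\<in>{..<q} \<times> {..<q}.
                  of_real (lagrange_poly2 q A t x) *
                  residual_kernel \<Psi> N A B (cheb_grid q A t) p)) \<le> \<epsilon>) \<and>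
            separated_approx (q^2) \<epsilon> (region A) (region B) (residual_kernel \<Psi> N A B)))"
      by (intro exI[of _ q] conjI allI impI ballI q q2)
        (auto intro!: errP' errX' separated_approx_square_sum q(1))
  qed (use C in auto)
qed

end
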